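(* Let $\gamma=(r_k)_{k\ge 0}$, $\sigma=(s_k)_{k\ge 0}$ and $\tau=(t_k)_{k\ge 1}$ be sequences of $q$-nonnegative polynomials in $q$, and suppose they satisfy at least one of the following five conditions: (1) $s_0\ge_q r_0$, and $s_k\ge_q r_k+t_k$ for $k\ge 1$; (2) $s_0\ge_q t_1$, and $s_k\ge_q r_{k-1}+t_{k+1}$ for $k\ge 1$; (3) $s_0\ge_q 1$, and $s_k\ge_q r_{k-1}t_k+1$ for $k\ge 1$; (4) $s_0\ge_q r_0t_1$, and $s_k\ge_q r_kt_{k+1}+1$ for $k\ge 1$; (5) there exist $q$-nonnegative polynomials $b_k,c_k$ ($k\ge 0$) such that $r_k=1$, $s_k=b_k+c_k$ and $t_{k+1}=b_{k+1}c_k$ for every $k\ge 0$. Then every immanant of every (finite) square submatrix of the Catalan-Stieltjes matrix $C^{\gamma,\sigma,\tau}$ is $q$-nonnegative, and every immanant of every square submatrix of the Hankel matrix $H^{\gamma,\sigma,\tau}$ is $q$-nonnegative.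
   Context: A polynomial in $q$ is $q$-nonnegative if all its coefficients are nonnegative; $f\ge_q g$ means $f-g$ is $q$-nonnegative. The Catalan-Stieltjes matrix $C^{\gamma,\sigma,\tau}=(c_{n,k})_{n,k\ge 0}$ is the infinite lower triangular matrix ($c_{n,k}=0$ for $k>n$) defined by $c_{0,0}=1$, $c_{n,0}=s_0c_{n-1,0}+t_1c_{n-1,1}$ and $c_{n,k}=r_{k-1}c_{n-1,k-1}+s_kc_{n-1,k}+t_{k+1}c_{n-1,k+1}$ for $n,k\ge 1$. Its Hankel matrix is $H^{\gamma,\sigma,\tau}=(c_{i+j,0})_{i,j\ge 0}$. For an $n\times n$ matrix $M=(m_{i,j})$ and a partition $\lambda$ of $n$, the immanant is $\mathrm{Imm}_\lambda M=\sum_{\pi\in\mathfrak S_n}\chi^\lambda(\pi)\prod_{i=1}^n m_{i,\pi(i)}$, where $\chi^\lambda$ is the irreducible character of the symmetric group $\mathfrak S_n$ indexed by $\lambda$. *)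

theory Defs
  imports
    "HOL-Library.Function_Algebras"
    "HOL-Computational_Algebra.Polynomial"
    "HOL-Combinatorics.Permutations"
    "Jordan_Normal_Form.Matrix"
begin

text \<open>
  Polynomials in \<open>q\<close> have real coefficients.
\<close>

definition q_nonneg :: "real poly \<Rightarrow> bool" where
  "q_nonneg p \<longleftrightarrow> (\<forall>i. coeff p i \<ge> 0)"

definition q_ge :: "real poly \<Rightarrow> real poly \<Rightarrow> bool" (infix "\<ge>\<^sub>q" 50) where
  "f \<ge>\<^sub>q g \<longleftrightarrow> q_nonneg (f - g)"

text \<open>
  Infinite matrices are functions \<open>nat \<Rightarrow> nat \<Rightarrow> real poly\<close>. The sequence \<open>t\<close> starts at index 1;
  the value \<open>t 0\<close> is never used.
\<close>

fun catalan_stieltjes ::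
  "(nat \<Rightarrow> real poly) \<Rightarrow> (nat \<Rightarrow> real poly) \<Rightarrow> (nat \<Rightarrow> real poly) \<Rightarrow> nat \<Rightarrow> nat \<Rightarrow> real poly"
where
  "catalan_stieltjes r s t 0 0 = 1"
| "catalan_stieltjes r s t 0 (Suc k) = 0"
| "catalan_stieltjes r s t (Suc n) 0 =
     s 0 * catalan_stieltjes r s t n 0 + t 1 * catalan_stieltjes r s t n 1"
| "catalan_stieltjes r s t (Suc n) (Suc k) =
     r k * catalan_stieltjes r s t n k
     + s (Suc k) * catalan_stieltjes r s t n (Suc k)
     + t (Suc (Suc k)) * catalan_stieltjes r s t n (Suc (Suc k))"

lemma catalan_stieltjes_lower_triangular:
  "n < k \<Longrightarrow> catalan_stieltjes r s t n k = 0"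
  by (induction r s t n k rule: catalan_stieltjes.induct) auto

definition hankel_matrix ::
  "(nat \<Rightarrow> real poly) \<Rightarrow> (nat \<Rightarrow> real poly) \<Rightarrow> (nat \<Rightarrow> real poly) \<Rightarrow> nat \<Rightarrow> nat \<Rightarrow> real poly"
where
  "hankel_matrix r s t i j = catalan_stieltjes r s t (i + j) 0"

definition square_submatrix :: "nat \<Rightarrow> (nat \<Rightarrow> nat \<Rightarrow> 'a) \<Rightarrow> 'a mat \<Rightarrow> bool" where
  "square_submatrix n A M \<longleftrightarrow>
     (\<exists>a b. strict_mono_on {..<n} a \<and> strict_mono_on {..<n} b \<and>
        M = mat n n (\<lambda>(i, j). A (a i) (b j)))"

definition is_partition :: "nat list \<Rightarrow> nat \<Rightarrow> bool" where
  "is_partition lam n \<longleftrightarrow> sorted_wrt (\<ge>) lam \<and> 0 \<notin> set lam \<and> sum_list lam = n"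


subsection \<open>Specht modules and the irreducible characters of the symmetric group\<close>

text \<open>
  The symmetric group on \<open>n\<close> letters is the group of \<open>\<pi> permutes {..<n}\<close>. The irreducible
  character indexed by a partition \<open>lam\<close> of \<open>n\<close> is the trace on the Specht module of \<open>lam\<close>:
  the span of the polytabloids inside the permutation module on the tabloids of shape \<open>lam\<close>.
  Specht modules are defined over the rationals, so working over the reals gives the
  same character as working over the complex numbers.
\<close>

definition cells :: "nat list \<Rightarrow> (nat \<times> nat) set" where
  "cells lam = {(i, j). i < length lam \<and> j < lam ! i}"

definition tableau :: "nat list \<Rightarrow> (nat \<times> nat \<Rightarrow> nat) \<Rightarrow> bool" where
  "tableau lam T \<longleftrightarrow> bij_betw T (cells lam) {..<sum_list lam}"

text \<open>
  A tabloid (a tableau up to reordering the entries within each row) is encoded as the list of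
  the entry sets of its rows.
\<close>

definition tabloid :: "nat list \<Rightarrow> (nat \<times> nat \<Rightarrow> nat) \<Rightarrow> nat set list" where
  "tabloid lam T = map (\<lambda>i. T ` {(i, j) |j. j < lam ! i}) [0..<length lam]"

definition column_stabilizer :: "nat list \<Rightarrow> (nat \<times> nat \<Rightarrow> nat) \<Rightarrow> (nat \<Rightarrow> nat) set" where
  "column_stabilizer lam T =
     {\<pi>. \<pi> permutes {..<sum_list lam} \<and>
        (\<forall>j. \<pi> ` (T ` {(i, j) |i. (i, j) \<in> cells lam}) = T ` {(i, j) |i. (i, j) \<in> cells lam})}"

text \<open>
  A formal linear combination of tabloids is the function giving its coefficients.
\<close>

definition polytabloid :: "nat list \<Rightarrow> (nat \<times> nat \<Rightarrow> nat) \<Rightarrow> nat set list \<Rightarrow> real" where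
  "polytabloid lam T = (\<lambda>X. \<Sum>\<pi>\<in>column_stabilizer lam T.
     of_int (sign \<pi>) * (if X = tabloid lam (\<pi> \<circ> T) then 1 else 0))"

interpretation fun_vs: vector_space "\<lambda>(c::real) (f::'a \<Rightarrow> real) x. c * f x"
  by unfold_locales (auto simp: fun_eq_iff algebra_simps)

definition specht_module :: "nat list \<Rightarrow> (nat set list \<Rightarrow> real) set" where
  "specht_module lam = fun_vs.span {polytabloid lam T |T. tableau lam T}"

text \<open>
  The linear extension of the action \<open>\<pi> \<cdot> {T} = {\<pi> \<circ> T}\<close> on tabloids, hence the inverse.
\<close>

definition perm_action ::
  "(nat \<Rightarrow> nat) \<Rightarrow> (nat set list \<Rightarrow> real) \<Rightarrow> nat set list \<Rightarrow> real"
where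
  "perm_action \<pi> v = (\<lambda>X. v (map ((`) (Hilbert_Choice.inv \<pi>)) X))"

text \<open>
  The trace of a linear endomorphism \<open>f\<close> of a finite-dimensional subspace \<open>V\<close>,
  computed in some basis (the value does not depend on which).
\<close>

definition trace_on :: "(('a \<Rightarrow> real) \<Rightarrow> 'a \<Rightarrow> real) \<Rightarrow> ('a \<Rightarrow> real) set \<Rightarrow> real" where
  "trace_on f V =
     (let B = (SOME B. fun_vs.independent B \<and> fun_vs.span B = V)
      in \<Sum>b\<in>B. fun_vs.representation B (f b) b)"

definition sym_char :: "nat list \<Rightarrow> (nat \<Rightarrow> nat) \<Rightarrow> real" where
  "sym_char lam \<pi> = trace_on (perm_action \<pi>) (specht_module lam)"

definition immanant :: "nat list \<Rightarrow> real poly mat \<Rightarrow> real poly" where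
  "immanant lam M =
     (\<Sum>\<pi> | \<pi> permutes {..<dim_row M}.
        Polynomial.smult (sym_char lam \<pi>) (\<Prod>i<dim_row M. M $$ (i, \<pi> i)))"

end

theory Submission
  imports Defs
begin

text \<open>
  Positivity of immanants is a statement about the elements \<open>\<Sum>\<^sub>w \<Prod>\<^sub>i m\<^bsub>i, w i\<^esub> w\<close> of the group algebra.
  In Young's seminormal basis \<open>1 + s\<close> is a nonnegative matrix for every adjacent transposition \<open>s\<close>,
  and so is the sum over any standard Young subgroup; no irreducibility is used, so the basis is built for an
  arbitrary real orthogonal representation. It consists of joint eigenvectors of the Jucys-Murphy operators,
  and its consistent normalisation follows from a rewriting system on weight vectors: an adjacent ascent
  of the weight is swapped and the vector is transported along. Commutation and the Yang-Baxter equation make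
  this system locally confluent, hence by Newman's lemma the transport to the normal form is unambiguous.

  If the support of a nonnegative matrix is a chain, its group algebra element is a nonnegative combination of
  products of two Young subgroup sums, and by a Cauchy-Binet formula with repeated indices the nonnegativity
  passes to products of matrices. Under each of the five conditions the tridiagonal matrix of the recurrence has
  the entries \<open>s\<^sub>k = A\<^sub>k C\<^sub>k + X\<^sub>k + F\<^sub>k D\<^sub>k\<close>, \<open>r\<^sub>k = F\<^sub>k C\<^bsub>k+1\<^esub>\<close>, \<open>t\<^bsub>k+1\<^esub> = A\<^bsub>k+1\<^esub> D\<^sub>k\<close> and so is a product of two such
  matrices; iterating the recurrence factors the Catalan-Stieltjes matrix, and the Hankel matrix is
  this matrix times the transpose of the one for the transposed tridiagonal matrix.
\<close>

subsection \<open>Young subgroups\<close>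

text \<open>The goal is strengthened twice. An immanant is a trace, but positivity of a trace does
  not survive products, so all matrix entries of the group algebra element are shown to be
  q-nonnegative. Strictly increasing row and column indices do not survive products either, since
  the intermediate indices of Cauchy-Binet repeat; weakly increasing index maps are therefore
  allowed throughout, and their stabilizers are the Young subgroups that appear. On a weight vector
  and its transport across a gap d > 1 the transposition acts with diagonal entries 1/d, -1/d and
  off-diagonal entries 1, 1 - 1/d^2, so 1 + s is nonnegative. The obstacle is to have this for all
  adjacent transpositions in one basis: different routes of swaps with the same endpoints must
  transport a vector to the same result. A Young subgroup sum is not built up from factors 1 + s;
  its invariance under each s ties its entries together, and its being a multiple of an idempotent
  excludes the negative sign.\<close>

lemma mono_on_lessThan_if_adjacent:
  fixes f :: "nat \<Rightarrow> 'a::order"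
  assumes "\<And>k. Suc k < n \<Longrightarrow> f k \<le> f (Suc k)"
  shows "mono_on {..<n} f"
proof (rule mono_onI)
  fix i j assume "i \<in> {..<n}" "j \<in> {..<n}" "i \<le> j"
  from \<open>i \<le> j\<close> \<open>j \<in> {..<n}\<close> show "f i \<le> f j"
  proof (induction j rule: dec_induct)
    case (step m)
    then show ?case using assms[of m] by (force intro: order_trans)
  qed simp
qed

text \<open>Both \<open>f\<close> and \<open>f \<circ> p\<close> list the same multiset of values in
  sorted order.\<close>

lemma mono_rearrangement_unique:
  fixes f :: "nat \<Rightarrow> 'a::linorder"
  assumes "mono_on {..<n} f" "mono_on {..<n} (f \<circ> p)" "p permutes {..<n}" "i < n"
  shows "f (p i) = f i"
proof -
  have sorted: "sorted (map g [0..<n])" if "mono_on {..<n} g" for g :: "nat \<Rightarrow> 'a"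
    using that by (auto simp: sorted_iff_nth_mono mono_on_def)
  have "mset (map (f \<circ> p) [0..<n]) = image_mset f (image_mset p (mset_set {..<n}))"
    by (simp add: image_mset.compositionality lessThan_atLeast0)
  also have "image_mset p (mset_set {..<n}) = mset_set {..<n}"
    by (simp add: image_mset_mset_set permutes_inj_on[OF assms(3)] permutes_image[OF assms(3)])
  finally have "mset (map (f \<circ> p) [0..<n]) = mset (map f [0..<n])"
    by (simp add: lessThan_atLeast0 comp_def)
  then have "map (f \<circ> p) [0..<n] = map f [0..<n]"
    using sorted assms(1,2) by (metis properties_for_sort)
  then show ?thesis using assms(4) by (auto simp: list_eq_iff_nth_eq)
qed

text \<open>The termination measure of the rewriting of weights and, for the negated values of a
  permutation, its set of inversions.\<close>

definition ascents :: "nat \<Rightarrow> (nat \<Rightarrow> 'a::linorder) \<Rightarrow> (nat \<times> nat) set" where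
  "ascents n \<alpha> = {(i, j). i < j \<and> j < n \<and> \<alpha> i < \<alpha> j}"

lemma finite_ascents: "finite (ascents n \<alpha>)"
  by (rule finite_subset[of _ "{..<n} \<times> {..<n}"]) (auto simp: ascents_def)

text \<open>Relabelling both positions by the transposition embeds the ascents after the swap into
  those before it; \<open>(k, Suc k)\<close> is missed, since it could only come from a pair in the
  wrong order.\<close>

lemma card_ascents_swap:
  assumes k: "Suc k < n" and d: "\<alpha> k < \<alpha> (Suc k)"
  shows "card (ascents n (\<alpha> \<circ> transpose k (Suc k))) < card (ascents n \<alpha>)"
proof -
  let ?s = "transpose k (Suc k)"
  have "map_prod ?s ?s ` ascents n (\<alpha> \<circ> ?s) \<subseteq> ascents n \<alpha> - {(k, Suc k)}"
  proof (clarsimp simp: ascents_def, intro conjI impI)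
    fix i j assume h: "i < j" "j < n" "\<alpha> (?s i) < \<alpha> (?s j)"
    have "\<not> (i = k \<and> j = Suc k)" using h d by auto
    then show "?s i < ?s j" using h(1) by (auto simp: transpose_def)
    show "?s j < n" using h k by (simp add: transpose_def)
    show "?s i = k \<Longrightarrow> ?s j \<noteq> Suc k" using h(1)
      by (metis less_asym lessI transpose_apply_first transpose_apply_second transpose_involutory)
  qed
  then have "card (map_prod ?s ?s ` ascents n (\<alpha> \<circ> ?s)) \<le> card (ascents n \<alpha> - {(k, Suc k)})"
    by (intro card_mono) (auto simp: finite_ascents)
  also have "\<dots> < card (ascents n \<alpha>)"
    using k d finite_ascents by (intro psubset_card_mono) (auto simp: ascents_def)
  finally show ?thesis
    by (subst (asm) card_image) (auto intro!: inj_on_subset[OF prod.inj_map] inj_transpose)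
qed

text \<open>The stabilizer of a weakly increasing \<open>a\<close> is a standard Young subgroup.\<close>

definition stab :: "nat \<Rightarrow> (nat \<Rightarrow> 'a) \<Rightarrow> (nat \<Rightarrow> nat) set" where
  "stab n a = {w. w permutes {..<n} \<and> (\<forall>i<n. a (w i) = a i)}"

lemma finite_stab: "finite (stab n a)"
  by (rule finite_subset[OF _ finite_permutations[of "{..<n}"]]) (auto simp: stab_def)

lemma id_in_stab: "id \<in> stab n a"
  by (simp add: stab_def permutes_id)

lemma card_stab_pos: "0 < card (stab n a)"
  using id_in_stab[of n a] finite_stab[of n a] card_gt_0_iff by blast

lemma permutes_less: "p permutes {..<n} \<Longrightarrow> i < n \<Longrightarrow> p i < n"
  using permutes_in_image[of p "{..<n}" i] by simp

lemma stab_permutes: "w \<in> stab n a \<Longrightarrow> w permutes {..<n}"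
  by (simp add: stab_def)

lemma comp_in_stab: "u \<in> stab n a \<Longrightarrow> w \<in> stab n a \<Longrightarrow> u \<circ> w \<in> stab n a"
  by (auto simp: stab_def permutes_compose permutes_less)

lemma inv_in_stab:
  assumes "u \<in> stab n a"
  shows "Hilbert_Choice.inv u \<in> stab n a"
proof -
  have u: "u permutes {..<n}" using assms by (simp add: stab_def)
  have "a (Hilbert_Choice.inv u i) = a i" if "i < n" for i
  proof -
    have "a (u (Hilbert_Choice.inv u i)) = a (Hilbert_Choice.inv u i)"
      using assms permutes_less[OF permutes_inv[OF u] that] by (simp add: stab_def)
    then show ?thesis by (simp add: permutes_inverses(1)[OF u])
  qed
  then show ?thesis using u by (simp add: stab_def permutes_inv)
qed

lemma comp_permutes_inv:
  assumes "u permutes A"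
  shows "u \<circ> (Hilbert_Choice.inv u \<circ> w) = w" "Hilbert_Choice.inv u \<circ> (u \<circ> w) = w" "w \<circ> Hilbert_Choice.inv u \<circ> u = w" "w \<circ> u \<circ> Hilbert_Choice.inv u = w"
  using permutes_inverses[OF assms] by (simp_all add: fun_eq_iff)

lemma bij_betw_comp_left_stab:
  assumes "u \<in> stab n a"
  shows "bij_betw ((\<circ>) u) (stab n a) (stab n a)"
  by (rule bij_betw_byWitness[where f' = "(\<circ>) (Hilbert_Choice.inv u)"])
    (simp_all add: assms image_subset_iff comp_in_stab inv_in_stab comp_permutes_inv[OF stab_permutes[OF assms]])

lemma bij_betw_comp_right_stab:
  assumes "u \<in> stab n a"
  shows "bij_betw (\<lambda>w. w \<circ> u) (stab n a) (stab n a)"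
  by (rule bij_betw_byWitness[where f' = "\<lambda>w. w \<circ> Hilbert_Choice.inv u"])
    (simp_all add: assms image_subset_iff comp_in_stab inv_in_stab comp_permutes_inv[OF stab_permutes[OF assms]])

text \<open>Bubble sort stays inside the Young subgroup: a descent of \<open>w\<close> at
  \<open>k\<close> gives \<open>a (Suc k) \<le> a k\<close>, monotonicity of \<open>a\<close> gives
  the converse, so the transposition removing the descent fixes \<open>a\<close> as well.\<close>

lemma stab_induct [consumes 2, case_names id swap]:
  fixes a :: "nat \<Rightarrow> 'a::linorder"
  assumes "mono_on {..<n} a" "w \<in> stab n a" "P id"
    and "\<And>w k. w \<in> stab n a \<Longrightarrow> Suc k < n \<Longrightarrow> a k = a (Suc k) \<Longrightarrow> P w \<Longrightarrow> P (w \<circ> transpose k (Suc k))"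
  shows "P w"
  using assms(2)
proof (induction "card (ascents n (\<lambda>i. - int (w i)))" arbitrary: w rule: less_induct)
  case less
  then have w: "w permutes {..<n}" "\<And>i. i < n \<Longrightarrow> a (w i) = a i" by (auto simp: stab_def)
  show ?case
  proof (cases "\<exists>k. Suc k < n \<and> w (Suc k) < w k")
    case False
    then have "mono_on {..<n} w" by (intro mono_on_lessThan_if_adjacent) (meson not_less)
    then have "w i = i" if "i < n" for i
      using mono_rearrangement_unique[of n id w i] w that by (simp add: mono_on_def)
    then have "w = id" using w(1) by (auto simp: fun_eq_iff permutes_def)
    then show ?thesis using assms(3) by simp
  next
    case True
    then obtain k where k: "Suc k < n" "w (Suc k) < w k" by blast
    let ?s = "transpose k (Suc k)"
    have "a k \<le> a (Suc k)" using assms(1) k by (simp add: mono_on_def)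
    moreover have "a (w (Suc k)) \<le> a (w k)" using assms(1) k w(1) by (simp add: mono_on_def permutes_less)
    ultimately have eq: "a k = a (Suc k)" using k w(2)[of k] w(2)[of "Suc k"] by simp
    have "?s \<in> stab n a" using k eq by (auto simp: stab_def permutes_swap_id transpose_def)
    then have ws: "w \<circ> ?s \<in> stab n a" using less.prems by (rule comp_in_stab[rotated])
    have "card (ascents n (\<lambda>i. - int ((w \<circ> ?s) i))) < card (ascents n (\<lambda>i. - int (w i)))"
      using card_ascents_swap[of k n "\<lambda>i. - int (w i)"] k by (simp add: comp_def)
    then have "P (w \<circ> ?s)" using less.hyps ws by blast
    then have "P (w \<circ> ?s \<circ> ?s)" using assms(4) ws k eq by blast
    then show ?thesis by (simp add: comp_assoc)
  qed
qed

subsection \<open>Joint eigenspaces of the Jucys-Murphy operators\<close>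

text \<open>Linearity is demanded on the ambient space, definiteness and closure only on
  \<open>V\<close>: in the application the ambient space consists of all real functions on lists of
  sets, where \<open>tabloid_inner\<close> is degenerate.\<close>

locale orthogonal_sym_rep = vector_space scale
  for scale :: "real \<Rightarrow> 'v::ab_group_add \<Rightarrow> 'v" (infixr "*s" 75) +
  fixes n :: nat and V :: "'v set" and ip :: "'v \<Rightarrow> 'v \<Rightarrow> real"
    and act :: "(nat \<Rightarrow> nat) \<Rightarrow> 'v \<Rightarrow> 'v"
  assumes subspace_V: "subspace V"
    and finite_dim: "\<exists>S. finite S \<and> V \<subseteq> span S"
    and ip_add_left: "ip (u + v) w = ip u w + ip v w"
    and ip_scale_left: "ip (c *s u) w = c * ip u w"
    and ip_commute: "ip u v = ip v u"
    and ip_pos: "v \<in> V \<Longrightarrow> v \<noteq> 0 \<Longrightarrow> ip v v > 0"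
    and act_add: "act p (u + v) = act p u + act p v"
    and act_scale: "act p (c *s u) = c *s act p u"
    and act_closed: "p permutes {..<n} \<Longrightarrow> v \<in> V \<Longrightarrow> act p v \<in> V"
    and act_comp: "p permutes {..<n} \<Longrightarrow> q permutes {..<n} \<Longrightarrow> act (p \<circ> q) v = act p (act q v)"
    and act_id: "act id v = v"
    and ip_act: "p permutes {..<n} \<Longrightarrow> ip (act p u) (act p v) = ip u v"
begin

lemma act_0 [simp]: "act p 0 = 0"
  using act_scale[of p 0 0] by simp

lemma act_minus: "act p (- u) = - act p u"
  using act_scale[of p "-1" u] by simp

lemma act_diff: "act p (u - v) = act p u - act p v"
  using act_add[of p u "- v"] by (simp add: act_minus)

lemma act_sum: "act p (\<Sum>i\<in>I. f i) = (\<Sum>i\<in>I. act p (f i))"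
  by (induction I rule: infinite_finite_induct) (auto simp: act_add)

lemma ip_add_right: "ip w (u + v) = ip w u + ip w v"
  by (metis ip_add_left ip_commute)

lemma ip_scale_right: "ip w (c *s u) = c * ip w u"
  by (metis ip_scale_left ip_commute)

lemma ip_0_left [simp]: "ip 0 u = 0"
  using ip_scale_left[of 0 0 u] by simp

lemma ip_0_right [simp]: "ip u 0 = 0"
  using ip_scale_right[of u 0 0] by simp

lemma ip_minus_left: "ip (- u) w = - ip u w"
  using ip_scale_left[of "-1" u w] by simp

lemma ip_diff_left: "ip (u - v) w = ip u w - ip v w"
  using ip_add_left[of u "- v" w] by (simp add: ip_minus_left)

lemma ip_diff_right: "ip w (u - v) = ip w u - ip w v"
  by (metis ip_diff_left ip_commute)

lemma ip_sum_left: "ip (\<Sum>i\<in>I. f i) w = (\<Sum>i\<in>I. ip (f i) w)"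
  by (induction I rule: infinite_finite_induct) (auto simp: ip_add_left)

lemma ip_sum_right: "ip w (\<Sum>i\<in>I. f i) = (\<Sum>i\<in>I. ip w (f i))"
  by (induction I rule: infinite_finite_induct) (auto simp: ip_add_right)

lemma ip_eq_0: "v \<in> V \<Longrightarrow> ip v v = 0 \<Longrightarrow> v = 0"
  using ip_pos[of v] by fastforce

lemma permutes_transpose: "i < n \<Longrightarrow> j < n \<Longrightarrow> transpose i j permutes {..<n}"
  by (simp add: permutes_swap_id)

lemma act_transpose_twice: "i < n \<Longrightarrow> j < n \<Longrightarrow> act (transpose i j) (act (transpose i j) v) = v"
  by (metis act_comp act_id permutes_transpose transpose_comp_involutory)

lemma ip_transpose: "i < n \<Longrightarrow> j < n \<Longrightarrow> ip (act (transpose i j) u) v = ip u (act (transpose i j) v)"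
  by (metis act_transpose_twice ip_act permutes_transpose)

lemma conj_transpose:
  assumes "p permutes {..<n}" "i < n" "j < n"
  shows "act p (act (transpose i j) v) = act (transpose (p i) (p j)) (act p v)"
proof -
  have "p \<circ> transpose i j = transpose (p i) (p j) \<circ> p"
    using assms(1) by (simp add: permutes_bij transpose_comp_eq fun_eq_iff bij_is_inj inj_eq transpose_def)
  moreover have "p i < n" "p j < n"
    using assms by (simp_all add: permutes_in_image[of p "{..<n}", simplified])
  ultimately show ?thesis
    using assms by (metis act_comp permutes_transpose)
qed

abbreviation S :: "nat \<Rightarrow> 'v \<Rightarrow> 'v" where
  "S k \<equiv> act (transpose k (Suc k))"

text \<open>The Jucys-Murphy element of the letter \<open>k\<close>. Letters count from 0, so
  \<open>JM 0\<close> is zero, the start of the induction for diagonalizability.\<close>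

definition JM :: "nat \<Rightarrow> 'v \<Rightarrow> 'v" where
  "JM k v = (\<Sum>l<k. act (transpose l k) v)"

lemma JM_add: "JM k (u + v) = JM k u + JM k v"
  by (simp add: JM_def act_add sum.distrib)

lemma JM_scale: "JM k (c *s u) = c *s JM k u"
  by (simp add: JM_def act_scale scale_sum_right)

lemma JM_0 [simp]: "JM k 0 = 0"
  by (simp add: JM_def)

lemma JM_diff: "JM k (u - v) = JM k u - JM k v"
  by (simp add: JM_def act_diff sum_subtractf)

lemma JM_sum: "JM k (\<Sum>i\<in>I. f i) = (\<Sum>i\<in>I. JM k (f i))"
  by (induction I rule: infinite_finite_induct) (auto simp: JM_add)

lemma JM_closed: "k < n \<Longrightarrow> v \<in> V \<Longrightarrow> JM k v \<in> V"
  unfolding JM_def by (intro subspace_sum subspace_V act_closed permutes_transpose) auto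

lemma ip_JM: "k < n \<Longrightarrow> ip (JM k u) v = ip u (JM k v)"
  unfolding JM_def ip_sum_left ip_sum_right by (intro sum.cong refl ip_transpose) auto

lemma S_twice [simp]: "Suc k < n \<Longrightarrow> S k (S k v) = v"
  by (simp add: act_transpose_twice)

lemma S_closed: "Suc k < n \<Longrightarrow> v \<in> V \<Longrightarrow> S k v \<in> V"
  by (simp add: act_closed permutes_transpose)

lemma JM_commute_act:
  assumes "p permutes {..<k}" "k < n"
  shows "JM k (act p v) = act p (JM k v)"
proof -
  have pn: "p permutes {..<n}" using assms permutes_subset[of p "{..<k}" "{..<n}"] by auto
  have pk: "p k = k" using assms by (simp add: permutes_not_in)
  have "act p (JM k v) = (\<Sum>l<k. act (transpose (p l) k) (act p v))"
    unfolding JM_def act_sum using assms pn pk by (intro sum.cong refl) (simp add: conj_transpose)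
  also have "\<dots> = (\<Sum>l<k. act (transpose l k) (act p v))"
    by (rule sum.reindex_bij_betw[OF permutes_imp_bij[OF assms(1)], of "\<lambda>l. act (transpose l k) (act p v)"])
  finally show ?thesis by (simp add: JM_def)
qed

lemma JM_S_commute:
  assumes "j < n" "Suc k < n" "j \<noteq> k" "j \<noteq> Suc k"
  shows "JM j (S k v) = S k (JM j v)"
proof (cases "j < k")
  case True
  then show ?thesis unfolding JM_def act_sum using assms
    by (intro sum.cong refl) (simp add: conj_transpose[of "transpose k (Suc k)"] permutes_transpose transpose_def)
next
  case False
  then have "Suc k < j" using assms by simp
  then have "transpose k (Suc k) permutes {..<j}" by (simp add: permutes_swap_id)
  then show ?thesis using assms by (simp add: JM_commute_act)
qed

text \<open>Conjugation by the adjacent transposition turns \<open>transpose l k\<close> into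
  \<open>transpose l (Suc k)\<close>; the one summand of \<open>JM (Suc k)\<close> left over is
  \<open>S k\<close> itself and contributes \<open>v\<close>.\<close>

lemma JM_Suc_S:
  assumes "Suc k < n"
  shows "JM (Suc k) (S k v) = S k (JM k v) + v"
proof -
  have "S k (JM k v) = (\<Sum>l<k. act (transpose l (Suc k)) (S k v))"
    unfolding JM_def act_sum using assms
    by (intro sum.cong refl) (simp add: conj_transpose[of "transpose k (Suc k)"] permutes_transpose transpose_def)
  then show ?thesis using assms by (simp add: JM_def)
qed

lemma JM_S:
  assumes "Suc k < n"
  shows "JM k (S k v) = S k (JM (Suc k) v) - v"
  using JM_Suc_S[OF assms, of "S k v"] assms by (simp add: act_add algebra_simps act_diff)

lemma JM_commute:
  assumes "i < n" "j < n"
  shows "JM i (JM j v) = JM j (JM i v)"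
proof -
  have *: "JM j (JM i v) = JM i (JM j v)" if "i < j" "j < n" for i j
  proof -
    have "JM j (JM i v) = (\<Sum>l<i. JM j (act (transpose l i) v))"
      by (simp add: JM_def[of i] JM_sum)
    also have "\<dots> = (\<Sum>l<i. act (transpose l i) (JM j v))"
      using that by (intro sum.cong refl JM_commute_act) (auto simp: permutes_swap_id)
    finally show ?thesis by (simp add: JM_def[of i])
  qed
  show ?thesis using *[of i j] *[of j i] assms by (cases i j rule: linorder_cases) auto
qed


definition eigenvectors :: "nat \<Rightarrow> 'v set" where
  "eigenvectors k = {z \<in> V. \<exists>c. JM k z = c *s z}"

lemma eigenvectors_subset: "eigenvectors k \<subseteq> V"
  by (auto simp: eigenvectors_def)

lemma span_eigenvectors_subset: "span (eigenvectors k) \<subseteq> V"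
  by (simp add: eigenvectors_subset span_minimal subspace_V)

lemma V_add: "u \<in> V \<Longrightarrow> v \<in> V \<Longrightarrow> u + v \<in> V"
  and V_diff: "u \<in> V \<Longrightarrow> v \<in> V \<Longrightarrow> u - v \<in> V"
  and V_scale: "u \<in> V \<Longrightarrow> c *s u \<in> V"
  and V_0: "0 \<in> V"
  using subspace_V by (auto intro: subspace_add subspace_diff subspace_scale subspace_0)

text \<open>A self-adjoint operator has no Jordan block: \<open>u\<close> lies in the image and in
  the kernel of \<open>JM k - c\<close>, which are orthogonal.\<close>

lemma eigenvector_if_generalized:
  assumes k: "k < n" and v: "v \<in> V"
    and u: "u = JM k v - c *s v" and z: "JM k u = c *s u"
  shows "JM k v = c *s v"
proof -
  have uV: "u \<in> V" using k v by (simp add: u V_diff V_scale JM_closed)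
  have "ip u u = ip u (JM k v) - c * ip u v" by (simp add: u ip_diff_right ip_scale_right)
  also have "ip u (JM k v) = c * ip u v" using ip_JM[OF k, of u v] z by (simp add: ip_scale_left)
  finally have "u = 0" using ip_eq_0[OF uV] by simp
  then show ?thesis using u by simp
qed

text \<open>Strips off one linear factor \<open>JM k - c\<close>. Every eigenvector with eigenvalue
  b different from c is \<open>JM k - c\<close> applied to a multiple of itself, so a sum of
  eigenvectors is in the image of \<open>JM k - c\<close> up to a vector \<open>y\<close> of the
  kernel; the absence of Jordan blocks disposes of \<open>y\<close>.\<close>

lemma eigenvectors_span_shift:
  assumes k: "k < n" and v: "v \<in> V"
    and sp: "JM k v - c *s v \<in> span (eigenvectors k)"
  shows "v \<in> span (eigenvectors k)"
proof -
  let ?E = "span (eigenvectors k)"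
  let ?U = "{u. \<exists>w\<in>?E. \<exists>y\<in>V. JM k y = c *s y \<and> u = (JM k w - c *s w) + y}"
  have "subspace ?U"
  proof (rule subspaceI, goal_cases)
    case 1
    show ?case using V_0 span_zero by (auto intro!: bexI[of _ 0])
  next
    case (2 x y)
    then obtain w1 y1 w2 y2 where h: "w1 \<in> ?E" "y1 \<in> V" "JM k y1 = c *s y1" "x = (JM k w1 - c *s w1) + y1"
      "w2 \<in> ?E" "y2 \<in> V" "JM k y2 = c *s y2" "y = (JM k w2 - c *s w2) + y2" by blast
    show ?case
      by (rule CollectI, rule bexI[of _ "w1 + w2"], rule bexI[of _ "y1 + y2"])
        (use h in \<open>auto simp: JM_add V_add span_add scale_right_distrib\<close>)
  next
    case (3 d x)
    then obtain w1 y1 where h: "w1 \<in> ?E" "y1 \<in> V" "JM k y1 = c *s y1" "x = (JM k w1 - c *s w1) + y1" by blast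
    show ?case
      by (rule CollectI, rule bexI[of _ "d *s w1"], rule bexI[of _ "d *s y1"])
        (use h in \<open>auto simp: JM_scale V_scale span_scale scale_right_distrib scale_right_diff_distrib mult.commute\<close>)
  qed
  moreover have "eigenvectors k \<subseteq> ?U"
  proof
    fix z assume z: "z \<in> eigenvectors k"
    then obtain b where b: "z \<in> V" "JM k z = b *s z" by (auto simp: eigenvectors_def)
    show "z \<in> ?U"
    proof (cases "b = c")
      case True
      then have "z = JM k 0 - c *s 0 + z" by simp
      then show ?thesis using b True span_zero by blast
    next
      case False
      have "z = (JM k ((1 / (b - c)) *s z) - c *s ((1 / (b - c)) *s z)) + 0"
        using b False
        by (simp add: JM_scale scale_left_diff_distrib[symmetric] diff_divide_distrib[symmetric])
      moreover have "(1 / (b - c)) *s z \<in> span (eigenvectors k)" using z by (simp add: span_scale span_base)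
      moreover have "JM k 0 = c *s 0" by simp
      ultimately show ?thesis using V_0 by blast
    qed
  qed
  ultimately have "?E \<subseteq> ?U" by (rule span_minimal[rotated])
  then obtain w y where w: "w \<in> ?E" "y \<in> V" "JM k y = c *s y" "JM k v - c *s v = (JM k w - c *s w) + y"
    using sp by blast
  have wV: "w \<in> V" using w span_eigenvectors_subset by blast
  have "y = JM k (v - w) - c *s (v - w)"
    using w by (simp add: JM_diff scale_right_diff_distrib algebra_simps)
  then have "JM k (v - w) = c *s (v - w)"
    using eigenvector_if_generalized[OF k, of "v - w" y c] w v wV V_diff by auto
  then have "v - w \<in> eigenvectors k" using v wV V_diff by (auto simp: eigenvectors_def)
  then show ?thesis using w(1) span_add[OF span_base, of "v - w" "eigenvectors k" w] by simp
qed

text \<open>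
  For \<open>X\<close>, \<open>Y\<close> consecutive Jucys-Murphy operators and \<open>s\<close> the adjacent transposition, the operator
  \<open>s (X - Y) + 1\<close> turns \<open>X\<close>-eigenvectors into \<open>Y\<close>-eigenvectors. Its square is \<open>1 - (X - Y)\<^sup>2\<close>, so if \<open>X\<close> is
  diagonalizable and \<open>X z = a z\<close>, then \<open>(Y - a - 1) (Y - a + 1) z\<close> is a sum of \<open>Y\<close>-eigenvectors.
\<close>

definition intertwiner :: "nat \<Rightarrow> 'v \<Rightarrow> 'v" where
  "intertwiner k u = S k (JM k u) - S k (JM (Suc k) u) + u"

lemma JM_intertwiner:
  assumes k: "Suc k < n"
  shows "JM (Suc k) (intertwiner k u) = intertwiner k (JM k u)"
  using k JM_commute[of k "Suc k" u]
  by (simp add: intertwiner_def JM_add JM_diff JM_Suc_S algebra_simps)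

lemma intertwiner_twice:
  assumes k: "Suc k < n"
  shows "intertwiner k (intertwiner k u) =
    u - (JM k (JM k u) - JM k (JM (Suc k) u) - JM k (JM (Suc k) u) + JM (Suc k) (JM (Suc k) u))"
  using k JM_commute[of "Suc k" k]
  by (simp add: intertwiner_def JM_add JM_diff JM_Suc_S JM_S act_add act_diff algebra_simps)

lemma intertwiner_add: "intertwiner k (u + v) = intertwiner k u + intertwiner k v"
  by (simp add: intertwiner_def JM_add act_add)

lemma intertwiner_scale: "intertwiner k (c *s u) = c *s intertwiner k u"
  by (simp add: intertwiner_def JM_scale act_scale scale_right_distrib scale_right_diff_distrib)

lemma intertwiner_closed: "Suc k < n \<Longrightarrow> u \<in> V \<Longrightarrow> intertwiner k u \<in> V"
  by (simp add: intertwiner_def V_add V_diff S_closed JM_closed)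

lemma JM_diagonalizable: "k < n \<Longrightarrow> V \<subseteq> span (eigenvectors k)"
proof (induction k)
  case 0
  show ?case by (auto simp: eigenvectors_def JM_def intro!: span_base exI[of _ 0])
next
  case (Suc k)
  let ?E = "span (eigenvectors (Suc k))"
  have "eigenvectors k \<subseteq> ?E"
  proof
    fix z assume "z \<in> eigenvectors k"
    then obtain a where z: "z \<in> V" "JM k z = a *s z" by (auto simp: eigenvectors_def)
    let ?U = "{u. intertwiner k u \<in> ?E}"
    have "subspace ?U"
    proof (rule subspaceI)
      have "intertwiner k 0 = 0" using intertwiner_scale[of k 0 0] by simp
      then show "0 \<in> ?U" by (simp add: span_zero)
    qed (simp_all add: intertwiner_add intertwiner_scale span_add span_scale)
    moreover have "eigenvectors k \<subseteq> ?U"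
      using Suc.prems
      by (auto simp: eigenvectors_def JM_intertwiner intertwiner_scale intertwiner_closed intro!: span_base)
    ultimately have "span (eigenvectors k) \<subseteq> ?U" by (rule span_minimal[rotated])
    \<comment> \<open>The inner \<open>intertwiner k z\<close> is again in \<open>V\<close>, hence a
      sum of eigenvectors of \<open>JM k\<close> by the induction hypothesis, and the outer one
      turns these into eigenvectors of \<open>JM (Suc k)\<close>.\<close>
    then have "intertwiner k (intertwiner k z) \<in> ?E"
      using Suc z intertwiner_closed[of k z] by auto
    \<comment> \<open>The two factors are stripped off one after the other, with c = a + 1 applied
      to \<open>u\<close> and then c = a - 1 applied to \<open>z\<close>.\<close>
    define u where "u = JM (Suc k) z - (a - 1) *s z"
    have "JM (Suc k) u - (a + 1) *s u = - intertwiner k (intertwiner k z)"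
      using Suc.prems JM_commute[of k "Suc k" z] z
      by (simp add: u_def intertwiner_twice JM_scale JM_diff scale_right_distrib scale_right_diff_distrib
          scale_left_distrib scale_left_diff_distrib JM_add algebra_simps)
    then have "JM (Suc k) u - (a + 1) *s u \<in> ?E"
      using \<open>intertwiner k (intertwiner k z) \<in> ?E\<close> span_neg by simp
    moreover have "u \<in> V" using z Suc.prems by (simp add: u_def V_diff V_scale JM_closed)
    ultimately have "u \<in> ?E" using eigenvectors_span_shift[OF Suc.prems] by blast
    then show "z \<in> ?E" using eigenvectors_span_shift[OF Suc.prems z(1)] unfolding u_def by blast
  qed
  then have "span (eigenvectors k) \<subseteq> ?E" by (simp add: span_minimal)
  then show ?case using Suc by auto
qed

lemma eigenvectors_orthogonal:
  assumes "k < n" "JM k u = a *s u" "JM k w = b *s w" "a \<noteq> b"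
  shows "ip u w = 0"
  using ip_JM[OF assms(1), of u w] assms by (simp add: ip_scale_left ip_scale_right)

lemma span_eigenvectors_decomp:
  assumes "v \<in> span (eigenvectors k)"
  shows "\<exists>I z. finite I \<and> (\<forall>c. z c \<in> V \<and> JM k (z c) = c *s z c) \<and> v = (\<Sum>c\<in>I. z c)"
proof -
  \<comment> \<open>Components are indexed by their eigenvalue and vanish outside \<open>I\<close>,
    so that two decompositions can be added over the union of their index sets.\<close>
  let ?U = "{v. \<exists>I z. finite I \<and> (\<forall>c. z c \<in> V \<and> JM k (z c) = c *s z c) \<and> (\<forall>c. c \<notin> I \<longrightarrow> z c = 0)
     \<and> v = (\<Sum>c\<in>I. z c)}"
  have "subspace ?U"
  proof (rule subspaceI, goal_cases)
    case 1
    show ?case by (rule CollectI, rule exI[of _ "{}"], rule exI[of _ "\<lambda>_. 0"]) (simp add: V_0)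
  next
    case (2 x y)
    then obtain I z J w where h: "finite I" "\<forall>c. z c \<in> V \<and> JM k (z c) = c *s z c" "\<forall>c. c \<notin> I \<longrightarrow> z c = 0"
        "x = (\<Sum>c\<in>I. z c)" "finite J" "\<forall>c. w c \<in> V \<and> JM k (w c) = c *s w c" "\<forall>c. c \<notin> J \<longrightarrow> w c = 0"
        "y = (\<Sum>c\<in>J. w c)" by blast
    have "x = (\<Sum>c\<in>I\<union>J. z c)" "y = (\<Sum>c\<in>I\<union>J. w c)"
      using h by (auto intro!: sum.mono_neutral_left)
    then show ?case using h
      by (intro CollectI exI[of _ "I \<union> J"] exI[of _ "\<lambda>c. z c + w c"])
        (auto simp: JM_add scale_right_distrib V_add sum.distrib)
  next
    case (3 d x)
    then obtain I z where h: "finite I" "\<forall>c. z c \<in> V \<and> JM k (z c) = c *s z c" "\<forall>c. c \<notin> I \<longrightarrow> z c = 0"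
        "x = (\<Sum>c\<in>I. z c)" by blast
    then show ?case
      by (intro CollectI exI[of _ I] exI[of _ "\<lambda>c. d *s z c"])
        (auto simp: JM_scale V_scale scale_sum_right mult.commute)
  qed
  moreover have "eigenvectors k \<subseteq> ?U"
  proof
    fix y assume "y \<in> eigenvectors k"
    then obtain b where "y \<in> V" "JM k y = b *s y" by (auto simp: eigenvectors_def)
    then show "y \<in> ?U"
      by (intro CollectI exI[of _ "{b}"] exI[of _ "\<lambda>c. if c = b then y else 0"]) (auto simp: V_0)
  qed
  ultimately have "v \<in> ?U" using span_minimal assms by blast
  then show ?thesis by blast
qed

lemma eigen_components_eq_0:
  assumes "k < n" "finite I" "\<And>c. c \<in> I \<Longrightarrow> y c \<in> V" "\<And>c. c \<in> I \<Longrightarrow> JM k (y c) = c *s y c"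
    "(\<Sum>c\<in>I. y c) = 0" "c \<in> I"
  shows "y c = 0"
proof -
  have "0 = ip (\<Sum>c\<in>I. y c) (y c)" using assms by simp
  also have "\<dots> = (\<Sum>b\<in>I. if b = c then ip (y c) (y c) else 0)"
    unfolding ip_sum_left using assms
    by (intro sum.cong refl) (simp add: eigenvectors_orthogonal[OF assms(1) assms(4) assms(4)])
  also have "\<dots> = ip (y c) (y c)" using assms by simp
  finally show ?thesis using ip_eq_0 assms by simp
qed

definition joint_eigenspace :: "(nat \<Rightarrow> real) \<Rightarrow> 'v set" where
  "joint_eigenspace \<alpha> = {v \<in> V. \<forall>k<n. JM k v = \<alpha> k *s v}"

text \<open>Weights are normalised to vanish beyond \<open>n\<close>, so that distinct weights have orthogonal eigenspaces.\<close>

definition weights :: "(nat \<Rightarrow> real) set" where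
  "weights = {\<alpha>. \<forall>k\<ge>n. \<alpha> k = 0}"

text \<open>Splitting a joint eigenvector of the first \<open>m\<close> operators into eigenvectors
  of \<open>JM m\<close> preserves the earlier eigenvalues: \<open>JM k - a\<close> annihilates the
  sum and commutes with \<open>JM m\<close>, so it annihilates each component.\<close>

lemma joint_eigenspaces_span: "V \<subseteq> span (\<Union>\<alpha>\<in>weights. joint_eigenspace \<alpha>)"
proof -
  have "m \<le> n \<Longrightarrow> V \<subseteq> span {z \<in> V. \<forall>k<m. \<exists>c. JM k z = c *s z}" for m
  proof (induction m)
    case 0
    show ?case by (auto intro: span_base)
  next
    case (Suc m)
    let ?E = "span {z \<in> V. \<forall>k<Suc m. \<exists>c. JM k z = c *s z}"
    have "{z \<in> V. \<forall>k<m. \<exists>c. JM k z = c *s z} \<subseteq> ?E"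
    proof (clarify)
      fix z assume z: "z \<in> V" "\<forall>k<m. \<exists>c. JM k z = c *s z"
      obtain I y where I: "finite I" "\<forall>c. y c \<in> V \<and> JM m (y c) = c *s y c" "z = (\<Sum>c\<in>I. y c)"
        using span_eigenvectors_decomp[of z m] JM_diagonalizable[of m] z Suc.prems by auto
      have "JM k (y c) = a *s y c" if k: "k < m" and a: "JM k z = a *s z" and c: "c \<in> I" for k a c
      proof -
        have "JM k (y c) - a *s y c = 0"
        proof (rule eigen_components_eq_0[of m I "\<lambda>c. JM k (y c) - a *s y c"])
          show "(\<Sum>c\<in>I. JM k (y c) - a *s y c) = 0"
            using a I(3) by (simp add: JM_sum sum_subtractf scale_sum_right)
          show "JM m (JM k (y b) - a *s y b) = b *s (JM k (y b) - a *s y b)" for b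
            using Suc.prems k I JM_commute[of m k "y b"]
            by (simp add: JM_diff JM_scale scale_right_diff_distrib mult.commute)
        qed (use Suc.prems k I c in \<open>auto intro!: V_diff V_scale JM_closed\<close>)
        then show ?thesis by simp
      qed
      then have "y c \<in> ?E" if "c \<in> I" for c
        using I z that by (intro span_base) (auto simp: less_Suc_eq, metis)
      then show "z \<in> ?E" unfolding I(3) by (intro span_sum) auto
    qed
    then have "span {z \<in> V. \<forall>k<m. \<exists>c. JM k z = c *s z} \<subseteq> ?E" by (simp add: span_minimal)
    then show ?case using Suc by auto
  qed
  from this[of n] have *: "V \<subseteq> span {z \<in> V. \<forall>k<n. \<exists>c. JM k z = c *s z}" by simp
  have "{z \<in> V. \<forall>k<n. \<exists>c. JM k z = c *s z} \<subseteq> (\<Union>\<alpha>\<in>weights. joint_eigenspace \<alpha>)"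
  proof (clarify)
    fix z assume z: "z \<in> V" "\<forall>k<n. \<exists>c. JM k z = c *s z"
    then obtain f where f: "\<forall>k<n. JM k z = f k *s z" by metis
    show "z \<in> (\<Union>\<alpha>\<in>weights. joint_eigenspace \<alpha>)"
      using z f by (intro UN_I[of "\<lambda>k. if k < n then f k else 0"]) (auto simp: weights_def joint_eigenspace_def)
  qed
  then show ?thesis using * span_mono by blast
qed

lemma joint_eigenspaces_orthogonal:
  assumes "\<alpha> \<in> weights" "\<beta> \<in> weights" "\<alpha> \<noteq> \<beta>" "u \<in> joint_eigenspace \<alpha>" "v \<in> joint_eigenspace \<beta>"
  shows "ip u v = 0"
proof -
  obtain k where k: "\<alpha> k \<noteq> \<beta> k" using assms by auto
  then have "k < n" using assms by (metis (mono_tags, lifting) mem_Collect_eq not_less weights_def)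
  then show ?thesis using eigenvectors_orthogonal[of k u "\<alpha> k" v "\<beta> k"] k assms
    by (auto simp: joint_eigenspace_def)
qed

end

section \<open>Newman's lemma and the rewriting of weight vectors by adjacent swaps\<close>

lemma newman_unique_normal_form:
  assumes wf: "wfp r\<inverse>\<inverse>"
    and local_confluence: "\<And>x y z. r x y \<Longrightarrow> r x z \<Longrightarrow> \<exists>u. r\<^sup>*\<^sup>* y u \<and> r\<^sup>*\<^sup>* z u"
  shows "\<exists>!y. r\<^sup>*\<^sup>* x y \<and> (\<nexists>z. r y z)"
proof -
  have ex: "\<exists>y. r\<^sup>*\<^sup>* x y \<and> (\<nexists>z. r y z)" for x
    using wf
  proof (induction x rule: wfp_induct_rule)
    case (less x)
    show ?case
    proof (cases "\<exists>z. r x z")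
      case True
      then show ?thesis using less by (metis conversepI converse_rtranclp_into_rtranclp)
    qed auto
  qed
  have "y = z" if "r\<^sup>*\<^sup>* x y" "\<nexists>w. r y w" "r\<^sup>*\<^sup>* x z" "\<nexists>w. r z w" for x y z
    using wf that
  proof (induction x arbitrary: y z rule: wfp_induct_rule)
    case (less x)
    show ?case
    proof (cases "x = y \<or> x = z")
      case True
      then show ?thesis using less.prems by (metis converse_rtranclpE)
    next
      case False
      then obtain y1 z1 where h: "r x y1" "r\<^sup>*\<^sup>* y1 y" "r x z1" "r\<^sup>*\<^sup>* z1 z"
        using less.prems by (metis converse_rtranclpE)
      then obtain u w where "r\<^sup>*\<^sup>* y1 u" "r\<^sup>*\<^sup>* z1 u" "r\<^sup>*\<^sup>* u w" "\<nexists>z. r w z"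
        using local_confluence ex by meson
      then have "y = w" "z = w"
        using less.IH[of y1 y w] less.IH[of z1 z w] h less.prems by (auto intro: rtranclp_trans)
      then show ?thesis by simp
    qed
  qed
  then show ?thesis using ex[of x] by blast
qed

context orthogonal_sym_rep
begin

text \<open>In a Specht module a weight is the content sequence of a standard tableau and this is
  the axial distance of consecutive letters.\<close>

definition gap :: "(nat \<Rightarrow> real) \<Rightarrow> nat \<Rightarrow> real" where
  "gap \<alpha> k = \<alpha> (Suc k) - \<alpha> k"

abbreviation swap :: "(nat \<Rightarrow> real) \<Rightarrow> nat \<Rightarrow> nat \<Rightarrow> real" where
  "swap \<alpha> k \<equiv> \<alpha> \<circ> transpose k (Suc k)"

text \<open>On vectors of weight \<open>\<alpha>\<close> this is \<open>intertwiner k\<close>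
  divided by \<open>- gap \<alpha> k\<close>.\<close>

definition lower :: "nat \<Rightarrow> (nat \<Rightarrow> real) \<Rightarrow> 'v \<Rightarrow> 'v" where
  "lower k \<alpha> v = S k v - (1 / gap \<alpha> k) *s v"

lemma swap_weights: "\<alpha> \<in> weights \<Longrightarrow> Suc k < n \<Longrightarrow> swap \<alpha> k \<in> weights"
  by (auto simp: weights_def transpose_def)

lemma gap_swap [simp]: "gap (swap \<alpha> k) k = - gap \<alpha> k"
  by (simp add: gap_def)

lemma swap_swap [simp]: "swap (swap \<alpha> k) k = \<alpha>"
  by (simp add: comp_assoc)

lemma subspace_joint_eigenspace: "subspace (joint_eigenspace \<alpha>)"
  by (rule subspaceI)
    (auto simp: joint_eigenspace_def V_0 V_add V_scale JM_add JM_scale scale_right_distrib mult.commute)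

lemma joint_eigenspace_subset: "joint_eigenspace \<alpha> \<subseteq> V"
  by (auto simp: joint_eigenspace_def)

text \<open>For gap 0 the operator \<open>JM (Suc k) - \<alpha> k\<close> would send
  \<open>S k v\<close> to \<open>v\<close> and \<open>v\<close> to 0, a Jordan block.\<close>

lemma gap_nonzero:
  assumes "v \<in> joint_eigenspace \<alpha>" "v \<noteq> 0" "Suc k < n"
  shows "gap \<alpha> k \<noteq> 0"
proof
  assume eq: "gap \<alpha> k = 0"
  have v: "v \<in> V" "JM k v = \<alpha> k *s v" "JM (Suc k) v = \<alpha> k *s v"
    using assms eq by (auto simp: joint_eigenspace_def gap_def)
  have *: "JM (Suc k) (S k v) = \<alpha> k *s S k v + v"
    using JM_Suc_S[OF assms(3)] v by (simp add: act_scale)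
  then have "JM (Suc k) (S k v) = \<alpha> k *s S k v"
    using eigenvector_if_generalized[of "Suc k" "S k v" v "\<alpha> k"] assms(3) v S_closed by simp
  then show False using * assms(2) by simp
qed

lemma lower_mem:
  assumes v: "v \<in> joint_eigenspace \<alpha>" and k: "Suc k < n" and d: "gap \<alpha> k \<noteq> 0"
  shows "lower k \<alpha> v \<in> joint_eigenspace (swap \<alpha> k)"
proof -
  have vV: "v \<in> V" and JMv: "\<And>j. j < n \<Longrightarrow> JM j v = \<alpha> j *s v"
    using v by (auto simp: joint_eigenspace_def)
  have "JM j (lower k \<alpha> v) = swap \<alpha> k j *s lower k \<alpha> v" if j: "j < n" for j
  proof -
    consider "j = k" | "j = Suc k" | "j \<noteq> k" "j \<noteq> Suc k" by blast
    then show ?thesis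
    proof cases
      case 1
      have "1 + \<alpha> k / gap \<alpha> k = \<alpha> (Suc k) / gap \<alpha> k" using d by (simp add: gap_def field_simps)
      then have "v + (\<alpha> k / gap \<alpha> k) *s v = (\<alpha> (Suc k) / gap \<alpha> k) *s v"
        by (metis scale_left_distrib scale_one)
      then show ?thesis using 1 k
        by (simp add: lower_def JM_diff JM_scale JM_S JMv act_scale scale_right_diff_distrib algebra_simps)
    next
      case 2
      have "1 + \<alpha> k / gap \<alpha> k = \<alpha> (Suc k) / gap \<alpha> k" using d by (simp add: gap_def field_simps)
      then have "v + (\<alpha> k / gap \<alpha> k) *s v = (\<alpha> (Suc k) / gap \<alpha> k) *s v"
        by (metis scale_left_distrib scale_one)
      then show ?thesis using 2 k
        by (simp add: lower_def JM_diff JM_scale JM_Suc_S JMv act_scale scale_right_diff_distrib algebra_simps)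
    next
      case 3
      then show ?thesis using j k
        by (simp add: lower_def JM_diff JM_scale JM_S_commute JMv act_scale scale_right_diff_distrib mult.commute)
    qed
  qed
  moreover have "lower k \<alpha> v \<in> V" using vV k by (simp add: lower_def V_diff V_scale S_closed)
  ultimately show ?thesis by (simp add: joint_eigenspace_def)
qed

lemma S_eq_lower: "S k v = (1 / gap \<alpha> k) *s v + lower k \<alpha> v"
  by (simp add: lower_def)

lemma lower_scale: "lower k \<alpha> (c *s v) = c *s lower k \<alpha> v"
  by (simp add: lower_def act_scale scale_right_diff_distrib mult.commute)

lemma lower_add: "lower k \<alpha> (u + v) = lower k \<alpha> u + lower k \<alpha> v"
  by (simp add: lower_def act_add scale_right_distrib)

lemma lower_0 [simp]: "lower k \<alpha> 0 = 0"
  by (simp add: lower_def)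

lemma lower_lower:
  assumes "Suc k < n"
  shows "lower k (swap \<alpha> k) (lower k \<alpha> v) = (1 - 1 / (gap \<alpha> k)\<^sup>2) *s v"
  using assms
  by (simp add: lower_def[of k "swap \<alpha> k"] act_add act_diff act_scale lower_def power2_eq_square
      scale_right_diff_distrib scale_left_diff_distrib)

text \<open>Pythagoras in \<open>S_eq_lower\<close>: \<open>S k\<close> is an isometry, and the two
  summands have different weights and so are orthogonal.\<close>

lemma ip_lower:
  assumes "\<alpha> \<in> weights" "v \<in> joint_eigenspace \<alpha>" "Suc k < n" "gap \<alpha> k \<noteq> 0"
  shows "ip (lower k \<alpha> v) (lower k \<alpha> v) = (1 - 1 / (gap \<alpha> k)\<^sup>2) * ip v v"
proof -
  have "swap \<alpha> k \<noteq> \<alpha>" using assms(4) by (metis gap_swap equal_neg_zero)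
  then have "ip v (lower k \<alpha> v) = 0"
    using joint_eigenspaces_orthogonal[OF assms(1) swap_weights[OF assms(1,3)] _ assms(2) lower_mem[OF assms(2-4)]]
    by auto
  moreover have "ip (S k v) (S k v) = ip v v" using assms(3) by (simp add: ip_act permutes_transpose)
  ultimately show ?thesis
    unfolding S_eq_lower[of k v \<alpha>]
    by (simp add: ip_add_left ip_add_right ip_scale_left ip_scale_right ip_commute[of "lower k \<alpha> v" v]
        power2_eq_square algebra_simps)
qed

text \<open>The norm in \<open>ip_lower\<close> cannot be negative, which keeps the gap out of the
  interval (-1, 1) and makes the diagonal entries of 1 + s nonnegative; for gap 1 or -1 the norm is
  zero.\<close>

lemma gap_ge_1:
  assumes "\<alpha> \<in> weights" "v \<in> joint_eigenspace \<alpha>" "v \<noteq> 0" "Suc k < n"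
  shows "\<bar>gap \<alpha> k\<bar> \<ge> 1" and "\<bar>gap \<alpha> k\<bar> = 1 \<Longrightarrow> lower k \<alpha> v = 0"
proof -
  have d: "gap \<alpha> k \<noteq> 0" using gap_nonzero assms by blast
  have L: "lower k \<alpha> v \<in> V" using lower_mem[OF assms(2,4) d] joint_eigenspace_subset by blast
  have v: "ip v v > 0" using assms ip_pos joint_eigenspace_subset by blast
  have "ip (lower k \<alpha> v) (lower k \<alpha> v) \<ge> 0" using ip_pos[OF L] by fastforce
  then have "1 - 1 / (gap \<alpha> k)\<^sup>2 \<ge> 0" unfolding ip_lower[OF assms(1,2,4) d] using v
    by (simp add: zero_le_mult_iff)
  then have "(gap \<alpha> k)\<^sup>2 \<ge> 1" using d by (simp add: field_simps)
  then show "\<bar>gap \<alpha> k\<bar> \<ge> 1" using abs_le_square_iff[of 1 "gap \<alpha> k"] by simp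
  assume "\<bar>gap \<alpha> k\<bar> = 1"
  then have "(gap \<alpha> k)\<^sup>2 = 1" by (simp add: power2_eq_1_iff abs_if split: if_splits)
  then have "ip (lower k \<alpha> v) (lower k \<alpha> v) = 0" by (simp add: ip_lower[OF assms(1,2,4) d])
  then show "lower k \<alpha> v = 0" using ip_eq_0[OF L] by simp
qed

text \<open>The strict bound excludes gap 1, where by \<open>gap_ge_1\<close> the vector is sent to
  0; for larger gaps \<open>lower\<close> is invertible by \<open>lower_lower\<close>.\<close>

inductive step :: "(nat \<Rightarrow> real) \<times> 'v \<Rightarrow> (nat \<Rightarrow> real) \<times> 'v \<Rightarrow> bool" where
  stepI: "\<alpha> \<in> weights \<Longrightarrow> v \<in> joint_eigenspace \<alpha> \<Longrightarrow> Suc k < n \<Longrightarrow> gap \<alpha> k > 1 \<Longrightarrow>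
    step (\<alpha>, v) (swap \<alpha> k, lower k \<alpha> v)"

lemma wfp_step: "wfp step\<inverse>\<inverse>"
proof (rule wfp_if_convertible_to_nat[of _ "\<lambda>(\<alpha>, v). card (ascents n \<alpha>)"])
  fix x y assume "step\<inverse>\<inverse> x y"
  then have "step y x" by simp
  then show "(case x of (\<alpha>, v) \<Rightarrow> card (ascents n \<alpha>)) < (case y of (\<alpha>, v) \<Rightarrow> card (ascents n \<alpha>))"
    by cases (simp add: card_ascents_swap gap_def)
qed

lemma act_braid:
  assumes "Suc (Suc k) < n"
  shows "S k (S (Suc k) (S k v)) = S (Suc k) (S k (S (Suc k) v))"
proof -
  let ?a = "transpose k (Suc k)" and ?b = "transpose (Suc k) (Suc (Suc k))"
  have "?a \<circ> (?b \<circ> ?a) = ?b \<circ> (?a \<circ> ?b)"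
    by (simp add: fun_eq_iff transpose_def)
  then have "act (?a \<circ> (?b \<circ> ?a)) v = act (?b \<circ> (?a \<circ> ?b)) v" by simp
  then show ?thesis using assms by (simp add: act_comp permutes_transpose permutes_compose)
qed

text \<open>The gaps met on the two routes are x, x + y, y and y, x + y, x. After expansion the
  cubic terms agree by the braid relation and the terms in \<open>S k\<close> and in
  \<open>S (Suc k)\<close> by 1/(xy) = 1/(x(x+y)) + 1/(y(x+y)).\<close>

lemma lower_yang_baxter:
  assumes k: "Suc (Suc k) < n" and pos: "gap \<alpha> k > 0" "gap \<alpha> (Suc k) > 0"
  shows "lower k (swap (swap \<alpha> k) (Suc k)) (lower (Suc k) (swap \<alpha> k) (lower k \<alpha> v)) =
    lower (Suc k) (swap (swap \<alpha> (Suc k)) k) (lower k (swap \<alpha> (Suc k)) (lower (Suc k) \<alpha> v))"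
proof -
  define x where "x = gap \<alpha> k"
  define y where "y = gap \<alpha> (Suc k)"
  have g: "gap (swap \<alpha> k) (Suc k) = x + y" "gap (swap (swap \<alpha> k) (Suc k)) k = y"
    "gap (swap \<alpha> (Suc k)) k = x + y" "gap (swap (swap \<alpha> (Suc k)) k) (Suc k) = x"
    by (simp_all add: gap_def x_def y_def transpose_def)
  have xy: "x > 0" "y > 0" using pos by (simp_all add: x_def y_def)
  have "x + y \<noteq> 0" using xy by simp
  define p where "p = 1 / x"
  define q where "q = 1 / y"
  define r where "r = 1 / (x + y)"
  have "p * q = p * r + q * r"
    using xy \<open>x + y \<noteq> 0\<close> by (simp add: p_def q_def r_def divide_simps)
  then have e: "(p * q) *s w = (p * r) *s w + (q * r) *s w" for w
    by (simp add: scale_left_distrib)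
  show ?thesis
    unfolding lower_def g x_def[symmetric] y_def[symmetric] p_def[symmetric] q_def[symmetric] r_def[symmetric]
    using k act_braid[OF k, of v] e[of "S k v"] e[of "S (Suc k) v"]
    by (simp add: act_add act_diff act_scale scale_right_diff_distrib algebra_simps)
qed

lemma act_far:
  assumes "Suc k < j" "Suc j < n"
  shows "S k (S j v) = S j (S k v)"
proof -
  have "transpose k (Suc k) \<circ> transpose j (Suc j) = transpose j (Suc j) \<circ> transpose k (Suc k)"
    using assms by (auto simp: fun_eq_iff transpose_def)
  then have "act (transpose k (Suc k) \<circ> transpose j (Suc j)) v = act (transpose j (Suc j) \<circ> transpose k (Suc k)) v"
    by simp
  then show ?thesis using assms by (simp add: act_comp permutes_transpose)
qed

lemma lower_far:
  assumes "Suc k < j" "Suc j < n"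
  shows "lower k (swap \<alpha> j) (lower j \<alpha> v) = lower j (swap \<alpha> k) (lower k \<alpha> v)"
proof -
  have g: "gap (swap \<alpha> j) k = gap \<alpha> k" "gap (swap \<alpha> k) j = gap \<alpha> j"
    using assms by (simp_all add: gap_def transpose_def)
  show ?thesis unfolding lower_def g
    using act_far[OF assms, of v]
    by (simp add: act_diff act_scale scale_right_diff_distrib algebra_simps)
qed

lemma swap_far: "Suc k < j \<Longrightarrow> swap (swap \<alpha> j) k = swap (swap \<alpha> k) j"
  by (auto simp: fun_eq_iff transpose_def)

lemma swap_braid: "swap (swap (swap \<alpha> k) (Suc k)) k = swap (swap (swap \<alpha> (Suc k)) k) (Suc k)"
  by (simp add: fun_eq_iff transpose_def)

lemma step_preserves:
  assumes "\<alpha> \<in> weights" "v \<in> joint_eigenspace \<alpha>" "Suc k < n" "gap \<alpha> k > 1"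
  shows "swap \<alpha> k \<in> weights" "lower k \<alpha> v \<in> joint_eigenspace (swap \<alpha> k)"
  using assms by (auto intro!: swap_weights lower_mem)

lemma step_locally_confluent:
  assumes "step x y" "step x z"
  shows "\<exists>u. step\<^sup>*\<^sup>* y u \<and> step\<^sup>*\<^sup>* z u"
proof -
  obtain \<alpha> v k where k: "\<alpha> \<in> weights" "v \<in> joint_eigenspace \<alpha>" "Suc k < n" "gap \<alpha> k > 1"
    "x = (\<alpha>, v)" "y = (swap \<alpha> k, lower k \<alpha> v)"
    using assms(1) by cases auto
  obtain j where j: "Suc j < n" "gap \<alpha> j > 1" "z = (swap \<alpha> j, lower j \<alpha> v)"
    using assms(2) k(5) by cases auto
  have adjacent: "\<exists>u. step\<^sup>*\<^sup>* (swap \<alpha> k, lower k \<alpha> v) u \<and> step\<^sup>*\<^sup>* (swap \<alpha> (Suc k), lower (Suc k) \<alpha> v) u"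
    if k: "Suc (Suc k) < n" "gap \<alpha> k > 1" "gap \<alpha> (Suc k) > 1" for k
  proof -
    \<comment> \<open>The later gaps on both routes are the sum of the two initial gaps or one of
      them, so all six sides of the hexagon are legitimate steps.\<close>
    have g: "gap (swap \<alpha> k) (Suc k) > 1" "gap (swap (swap \<alpha> k) (Suc k)) k > 1"
      "gap (swap \<alpha> (Suc k)) k > 1" "gap (swap (swap \<alpha> (Suc k)) k) (Suc k) > 1"
      using k by (simp_all add: gap_def transpose_def)
    note a = step_preserves[OF \<open>\<alpha> \<in> weights\<close> \<open>v \<in> joint_eigenspace \<alpha>\<close> Suc_lessD[OF k(1)] k(2)]
    note a' = step_preserves[OF a k(1) g(1)]
    note b = step_preserves[OF \<open>\<alpha> \<in> weights\<close> \<open>v \<in> joint_eigenspace \<alpha>\<close> k(1,3)]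
    note b' = step_preserves[OF b Suc_lessD[OF k(1)] g(3)]
    have "step\<^sup>*\<^sup>* (swap \<alpha> k, lower k \<alpha> v)
      (swap (swap (swap \<alpha> k) (Suc k)) k, lower k (swap (swap \<alpha> k) (Suc k)) (lower (Suc k) (swap \<alpha> k) (lower k \<alpha> v)))"
      using stepI[OF a k(1) g(1)] stepI[OF a' Suc_lessD[OF k(1)] g(2)]
      by (meson r_into_rtranclp rtranclp.rtrancl_into_rtrancl)
    moreover have "step\<^sup>*\<^sup>* (swap \<alpha> (Suc k), lower (Suc k) \<alpha> v)
      (swap (swap (swap \<alpha> (Suc k)) k) (Suc k),
        lower (Suc k) (swap (swap \<alpha> (Suc k)) k) (lower k (swap \<alpha> (Suc k)) (lower (Suc k) \<alpha> v)))"
      using stepI[OF b Suc_lessD[OF k(1)] g(3)] stepI[OF b' k(1) g(4)]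
      by (meson r_into_rtranclp rtranclp.rtrancl_into_rtrancl)
    ultimately show ?thesis
      using lower_yang_baxter[of k \<alpha> v] swap_braid[of \<alpha> k] k by auto
  qed
  have far: "\<exists>u. step\<^sup>*\<^sup>* (swap \<alpha> k, lower k \<alpha> v) u \<and> step\<^sup>*\<^sup>* (swap \<alpha> j, lower j \<alpha> v) u"
    if h: "Suc k < j" "Suc j < n" "gap \<alpha> k > 1" "gap \<alpha> j > 1" for k j
  proof -
    have kn: "Suc k < n" using h by simp
    have g: "gap (swap \<alpha> k) j > 1" "gap (swap \<alpha> j) k > 1"
      using h by (simp_all add: gap_def transpose_def)
    note a = step_preserves[OF \<open>\<alpha> \<in> weights\<close> \<open>v \<in> joint_eigenspace \<alpha>\<close> kn h(3)]
    note b = step_preserves[OF \<open>\<alpha> \<in> weights\<close> \<open>v \<in> joint_eigenspace \<alpha>\<close> h(2,4)]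
    show ?thesis
      using stepI[OF a h(2) g(1)] stepI[OF b kn g(2)] lower_far[OF h(1,2), of \<alpha> v] swap_far[OF h(1), of \<alpha>]
      by auto
  qed
  consider "j = k" | "j = Suc k" | "k = Suc j" | "Suc k < j" | "Suc j < k" by linarith
  then show ?thesis
  proof cases
    case 1 then show ?thesis using k j by auto
  next
    case 2 then show ?thesis using adjacent[of k] k j by auto
  next
    case 3 then show ?thesis using adjacent[of j] k j by auto
  next
    case 4 then show ?thesis using far[of k j] k j by auto
  next
    case 5 then show ?thesis using far[of j k] k j by auto
  qed
qed

end

subsection \<open>The seminormal basis\<close>

context orthogonal_sym_rep
begin

definition normal_form :: "(nat \<Rightarrow> real) \<times> 'v \<Rightarrow> (nat \<Rightarrow> real) \<times> 'v" where
  "normal_form x = (THE y. step\<^sup>*\<^sup>* x y \<and> (\<nexists>z. step y z))"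

lemma normal_form_props: "step\<^sup>*\<^sup>* x (normal_form x) \<and> (\<nexists>z. step (normal_form x) z)"
  unfolding normal_form_def
  by (rule theI', rule newman_unique_normal_form[OF wfp_step step_locally_confluent])

lemma normal_form_unique: "step\<^sup>*\<^sup>* x y \<Longrightarrow> \<nexists>z. step y z \<Longrightarrow> normal_form x = y"
  unfolding normal_form_def
  by (rule the1_equality, rule newman_unique_normal_form[OF wfp_step step_locally_confluent]) auto

lemma normal_form_step: "step x y \<Longrightarrow> normal_form x = normal_form y"
  using normal_form_props[of y] by (intro normal_form_unique) (auto intro: converse_rtranclp_into_rtranclp)

definition chosen_basis :: "(nat \<Rightarrow> real) \<Rightarrow> 'v set" where
  "chosen_basis \<alpha> = (SOME B. B \<subseteq> joint_eigenspace \<alpha> \<and> independent B \<and> joint_eigenspace \<alpha> \<subseteq> span B)"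

lemma chosen_basis_props:
  "chosen_basis \<alpha> \<subseteq> joint_eigenspace \<alpha> \<and> independent (chosen_basis \<alpha>) \<and> joint_eigenspace \<alpha> \<subseteq> span (chosen_basis \<alpha>)"
  unfolding chosen_basis_def
  by (rule someI_ex) (metis maximal_independent_subset)

text \<open>A basis is chosen freely at a terminal weight and pulled back along the transport.
  Unique normal forms make \<open>lower\<close> match these bases whichever swap is taken; whole
  bases occur because weight spaces may have dimension above 1.\<close>

definition weight_basis :: "(nat \<Rightarrow> real) \<Rightarrow> 'v set" where
  "weight_basis \<alpha> = {v \<in> joint_eigenspace \<alpha>. snd (normal_form (\<alpha>, v)) \<in> chosen_basis (fst (normal_form (\<alpha>, v)))}"

lemma weight_basis_lower:
  assumes "\<alpha> \<in> weights" "v \<in> joint_eigenspace \<alpha>" "Suc k < n" "gap \<alpha> k > 1"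
  shows "lower k \<alpha> v \<in> weight_basis (swap \<alpha> k) \<longleftrightarrow> v \<in> weight_basis \<alpha>"
  using normal_form_step[OF stepI[OF assms]] step_preserves[OF assms] assms(2)
  by (simp add: weight_basis_def)

text \<open>The inverse of \<open>lower k (swap \<alpha> k)\<close>, by \<open>lower_lower\<close>;
  used for gaps below -1, where the step leads from \<open>swap \<alpha> k\<close> to
  \<open>\<alpha>\<close>.\<close>

definition raise :: "nat \<Rightarrow> (nat \<Rightarrow> real) \<Rightarrow> 'v \<Rightarrow> 'v" where
  "raise k \<alpha> v = (1 / (1 - 1 / (gap \<alpha> k)\<^sup>2)) *s lower k \<alpha> v"

lemma raise_add: "raise k \<alpha> (u + v) = raise k \<alpha> u + raise k \<alpha> v"
  by (simp add: raise_def lower_add scale_right_distrib)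

lemma raise_scale: "raise k \<alpha> (c *s v) = c *s raise k \<alpha> v"
  by (simp add: raise_def lower_scale mult.commute)

lemma raise_0 [simp]: "raise k \<alpha> 0 = 0"
  by (simp add: raise_def)

lemma one_minus_inverse_square_pos: "1 < \<bar>x\<bar> \<Longrightarrow> 0 < 1 - 1 / (x::real)\<^sup>2"
  using power_strict_mono[of 1 "\<bar>x\<bar>" 2] by simp

lemma raise_lower:
  assumes "Suc k < n" "\<bar>gap \<alpha> k\<bar> > 1"
  shows "raise k (swap \<alpha> k) (lower k \<alpha> v) = v"
  using assms one_minus_inverse_square_pos[of "gap \<alpha> k"] by (simp add: raise_def lower_lower)

lemma lower_raise:
  assumes "Suc k < n" "\<bar>gap \<alpha> k\<bar> > 1"
  shows "lower k (swap \<alpha> k) (raise k \<alpha> v) = v"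
  using assms one_minus_inverse_square_pos[of "gap \<alpha> k"] by (simp add: raise_def lower_scale lower_lower)

lemma raise_mem:
  assumes "v \<in> joint_eigenspace \<alpha>" "Suc k < n" "gap \<alpha> k \<noteq> 0"
  shows "raise k \<alpha> v \<in> joint_eigenspace (swap \<alpha> k)"
  unfolding raise_def by (rule subspace_scale[OF subspace_joint_eigenspace lower_mem[OF assms]])

lemma weight_basis_raise:
  assumes "\<alpha> \<in> weights" "v \<in> joint_eigenspace \<alpha>" "Suc k < n" "gap \<alpha> k < -1"
  shows "raise k \<alpha> v \<in> weight_basis (swap \<alpha> k) \<longleftrightarrow> v \<in> weight_basis \<alpha>"
  using weight_basis_lower[of "swap \<alpha> k" "raise k \<alpha> v" k] assms
  by (simp add: swap_weights raise_mem lower_raise)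

lemma weight_basis_subset: "weight_basis \<alpha> \<subseteq> joint_eigenspace \<alpha>"
  by (auto simp: weight_basis_def)

text \<open>At a terminal weight every vector is its own normal form and the basis is the chosen
  one. Otherwise \<open>lower\<close> and \<open>raise\<close> are mutually inverse linear maps that
  match the basis with that of a weight having fewer ascents.\<close>

lemma weight_basis_props:
  assumes "\<alpha> \<in> weights"
  shows "independent (weight_basis \<alpha>) \<and> joint_eigenspace \<alpha> \<subseteq> span (weight_basis \<alpha>)"
  using assms
proof (induction "card (ascents n \<alpha>)" arbitrary: \<alpha> rule: less_induct)
  case less
  show ?case
  proof (cases "\<exists>k. Suc k < n \<and> gap \<alpha> k > 1")
    case False
    then have "normal_form (\<alpha>, v) = (\<alpha>, v)" for v
      by (intro normal_form_unique) (auto elim!: step.cases)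
    then have "weight_basis \<alpha> = chosen_basis \<alpha>"
      using chosen_basis_props[of \<alpha>] by (auto simp: weight_basis_def)
    then show ?thesis using chosen_basis_props by simp
  next
    case True
    then obtain k where k: "Suc k < n" "gap \<alpha> k > 1" by blast
    define \<beta> where "\<beta> = swap \<alpha> k"
    define f where "f = lower k \<alpha>"
    define g where "g = raise k \<beta>"
    have \<beta>: "\<beta> \<in> weights" "gap \<beta> k < -1" "swap \<beta> k = \<alpha>" "card (ascents n \<beta>) < card (ascents n \<alpha>)"
      unfolding \<beta>_def using k less.prems by (simp_all add: swap_weights card_ascents_swap gap_def[of \<alpha>])
    have IH: "independent (weight_basis \<beta>)" "joint_eigenspace \<beta> \<subseteq> span (weight_basis \<beta>)"
      using less.hyps[OF \<beta>(4,1)] by auto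
    have gf: "g (f v) = v" for v
      using raise_lower[of k \<alpha> v] k by (simp add: f_def g_def \<beta>_def)
    have fg: "f (g v) = v" for v
      using lower_raise[of k \<beta> v] k \<beta> by (simp add: f_def g_def)
    have f_basis: "f v \<in> weight_basis \<beta>" if "v \<in> weight_basis \<alpha>" for v
      using weight_basis_lower[of \<alpha> v k] that less.prems k weight_basis_subset
      by (auto simp: f_def \<beta>_def)
    have g_basis: "g v \<in> weight_basis \<alpha>" if "v \<in> weight_basis \<beta>" for v
      using weight_basis_raise[of \<beta> v k] that \<beta> k weight_basis_subset
      by (auto simp: g_def)
    have "v \<in> span (weight_basis \<alpha>)" if v: "v \<in> joint_eigenspace \<alpha>" for v
    proof -
      have "subspace {w. g w \<in> span (weight_basis \<alpha>)}"
        by (rule subspaceI)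
          (simp_all add: g_def raise_add raise_scale span_zero span_add span_scale)
      then have "span (weight_basis \<beta>) \<subseteq> {w. g w \<in> span (weight_basis \<alpha>)}"
        using g_basis by (intro span_minimal) (auto intro: span_base)
      moreover have "f v \<in> span (weight_basis \<beta>)"
        using IH(2) lower_mem[OF v k(1)] k by (auto simp: f_def \<beta>_def)
      ultimately show ?thesis using gf[of v] by auto
    qed
    moreover have "independent (weight_basis \<alpha>)"
      unfolding dependent_def
    proof (clarify)
      fix b assume b: "b \<in> weight_basis \<alpha>" "b \<in> span (weight_basis \<alpha> - {b})"
      have "subspace {v. f v \<in> span (weight_basis \<beta> - {f b})}"
        by (rule subspaceI)
          (simp_all add: f_def lower_add lower_scale span_zero span_add span_scale)
      moreover have "weight_basis \<alpha> - {b} \<subseteq> {v. f v \<in> span (weight_basis \<beta> - {f b})}"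
      proof
        fix v assume v: "v \<in> weight_basis \<alpha> - {b}"
        then have "f v \<noteq> f b" using gf by (metis DiffE singletonI)
        then show "v \<in> {v. f v \<in> span (weight_basis \<beta> - {f b})}"
          using v f_basis by (auto intro: span_base)
      qed
      ultimately have "f b \<in> span (weight_basis \<beta> - {f b})"
        using b(2) span_minimal by blast
      then show False using IH(1) f_basis[OF b(1)] by (auto simp: dependent_def)
    qed
    ultimately show ?thesis by blast
  qed
qed

definition seminormal_basis :: "'v set" where
  "seminormal_basis = (\<Union>\<alpha>\<in>weights. weight_basis \<alpha>)"

lemma seminormal_basis_subset: "seminormal_basis \<subseteq> V"
  using weight_basis_subset joint_eigenspace_subset by (force simp: seminormal_basis_def)

lemma span_seminormal_basis: "span seminormal_basis = V"
proof
  show "span seminormal_basis \<subseteq> V" using seminormal_basis_subset by (simp add: span_minimal subspace_V)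
  have "(\<Union>\<alpha>\<in>weights. joint_eigenspace \<alpha>) \<subseteq> span seminormal_basis"
    using weight_basis_props span_mono[of "weight_basis _" seminormal_basis]
    by (force simp: seminormal_basis_def)
  then have "span (\<Union>\<alpha>\<in>weights. joint_eigenspace \<alpha>) \<subseteq> span seminormal_basis"
    by (simp add: span_minimal)
  then show "V \<subseteq> span seminormal_basis" using joint_eigenspaces_span by blast
qed

lemma independent_seminormal_basis: "independent seminormal_basis"
  unfolding dependent_def
proof (clarify)
  fix b assume b: "b \<in> seminormal_basis" "b \<in> span (seminormal_basis - {b})"
  then obtain \<alpha> where \<alpha>: "\<alpha> \<in> weights" "b \<in> weight_basis \<alpha>" by (auto simp: seminormal_basis_def)
  define R where "R = (\<Union>\<beta>\<in>weights - {\<alpha>}. weight_basis \<beta>)"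
  have "seminormal_basis - {b} \<subseteq> (weight_basis \<alpha> - {b}) \<union> R"
    by (auto simp: seminormal_basis_def R_def)
  then have "b \<in> span ((weight_basis \<alpha> - {b}) \<union> R)" using b(2) span_mono by blast
  then obtain x y where xy: "b = x + y" "x \<in> span (weight_basis \<alpha> - {b})" "y \<in> span R"
    unfolding span_Un by blast
  have "x \<in> joint_eigenspace \<alpha>"
    using xy(2) weight_basis_subset[of \<alpha>] subspace_joint_eigenspace span_minimal[of "weight_basis \<alpha> - {b}"]
    by blast
  then have y: "y \<in> joint_eigenspace \<alpha>"
    using subspace_diff[OF subspace_joint_eigenspace, of b \<alpha> x] \<alpha>(2) weight_basis_subset xy(1) by auto
  have "subspace {w. ip w y = 0}" by (rule subspaceI) (auto simp: ip_add_left ip_scale_left)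
  moreover have "R \<subseteq> {w. ip w y = 0}"
    using joint_eigenspaces_orthogonal[OF _ \<alpha>(1) _ _ y] weight_basis_subset by (auto simp: R_def)
  ultimately have "ip y y = 0" using xy(3) span_minimal by blast
  then have "y = 0" using ip_eq_0 y joint_eigenspace_subset by blast
  then have "b \<in> span (weight_basis \<alpha> - {b})" using xy by simp
  then show False using weight_basis_props[OF \<alpha>(1)] \<alpha>(2) by (auto simp: dependent_def)
qed

lemma finite_seminormal_basis: "finite seminormal_basis"
proof -
  obtain T where "finite T" "V \<subseteq> span T" using finite_dim by blast
  then show ?thesis
    using independent_span_bound[of T seminormal_basis] independent_seminormal_basis seminormal_basis_subset by blast
qed

text \<open>All that the positivity argument uses of the basis: \<open>\<sigma>\<close> pairs a
  vector with its transport, \<open>d\<close> is its gap, and the off-diagonal entry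
  \<open>g\<close> is 1 when lowering and 1 - 1/d^2 when raising.\<close>

lemma seminormal_form:
  assumes k: "Suc k < n"
  shows "\<exists>\<sigma> d g. \<forall>b\<in>seminormal_basis. \<sigma> b \<in> seminormal_basis \<and> \<sigma> (\<sigma> b) = b \<and>
    S k b = (1 / d b) *s b + g b *s \<sigma> b \<and>
    (\<sigma> b = b \<and> g b = 0 \<and> \<bar>d b\<bar> = 1 \<or> 1 < \<bar>d b\<bar> \<and> g b > 0 \<and> d (\<sigma> b) = - d b \<and> g (\<sigma> b) > 0)"
proof -
  let ?B = seminormal_basis
  \<comment> \<open>Basis vectors are nonzero and weight spaces orthogonal, so the choice is in fact
    forced (\<open>wt_eq\<close>).\<close>
  define wt where "wt b = (SOME \<alpha>. \<alpha> \<in> weights \<and> b \<in> weight_basis \<alpha>)" for b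
  have wt: "wt b \<in> weights \<and> b \<in> weight_basis (wt b)" if "b \<in> ?B" for b
    unfolding wt_def using that by (intro someI_ex[of "\<lambda>\<alpha>. \<alpha> \<in> weights \<and> b \<in> weight_basis \<alpha>"]) (auto simp: seminormal_basis_def)
  have nz: "b \<noteq> 0" if "b \<in> ?B" for b
    using that independent_seminormal_basis dependent_zero by blast
  have wt_eq: "wt b = \<alpha>" if "\<alpha> \<in> weights" "b \<in> weight_basis \<alpha>" for b \<alpha>
  proof (rule ccontr)
    assume ne: "wt b \<noteq> \<alpha>"
    have b: "b \<in> ?B" using that by (auto simp: seminormal_basis_def)
    have "ip b b = 0"
      using joint_eigenspaces_orthogonal[of "wt b" \<alpha> b b] wt[OF b] that ne weight_basis_subset by blast
    then show False using ip_eq_0 nz[OF b] b seminormal_basis_subset by blast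
  qed
  define d where "d b = gap (wt b) k" for b
  define g where "g b = (if d b > 1 then 1 else if d b < -1 then 1 - 1 / (d b)\<^sup>2 else 0)" for b
  define \<sigma> where "\<sigma> b = (if d b > 1 then lower k (wt b) b else if d b < -1 then raise k (wt b) b else b)" for b
  have "\<sigma> b \<in> ?B \<and> \<sigma> (\<sigma> b) = b \<and> S k b = (1 / d b) *s b + g b *s \<sigma> b \<and>
    (\<sigma> b = b \<and> g b = 0 \<and> \<bar>d b\<bar> = 1 \<or> 1 < \<bar>d b\<bar> \<and> g b > 0 \<and> d (\<sigma> b) = - d b \<and> g (\<sigma> b) > 0)"
    if b: "b \<in> ?B" for b
  proof -
    have w: "wt b \<in> weights" "b \<in> weight_basis (wt b)" "b \<in> joint_eigenspace (wt b)"
      using wt[OF b] weight_basis_subset by auto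
    have sw: "swap (wt b) k \<in> weights" using w k by (simp add: swap_weights)
    consider "d b > 1" | "d b < -1" | "\<bar>d b\<bar> = 1"
      using gap_ge_1(1)[OF w(1,3) nz[OF b] k] by (fold d_def) linarith
    then show ?thesis
    proof cases
      case 1
      have \<sigma>: "\<sigma> b = lower k (wt b) b" using 1 by (simp add: \<sigma>_def)
      have mem: "\<sigma> b \<in> weight_basis (swap (wt b) k)"
        unfolding \<sigma> using weight_basis_lower[OF w(1,3) k] 1 w(2) by (simp add: d_def)
      have wt': "wt (\<sigma> b) = swap (wt b) k" using wt_eq[OF sw mem] .
      have d': "d (\<sigma> b) = - d b" by (simp add: d_def wt')
      have "\<sigma> (\<sigma> b) = b"
        using 1 d' raise_lower[OF k, of "wt b" b] wt' by (simp add: \<sigma>_def[of "\<sigma> b"]) (simp add: \<sigma> d_def)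
      moreover have "\<sigma> b \<in> ?B" using mem sw by (auto simp: seminormal_basis_def)
      moreover have "S k b = (1 / d b) *s b + g b *s \<sigma> b"
        using 1 S_eq_lower[of k b "wt b"] by (simp add: g_def \<sigma> d_def)
      moreover have "g b > 0" "g (\<sigma> b) > 0"
        using 1 d' one_minus_inverse_square_pos[of "d b"] by (simp_all add: g_def)
      ultimately show ?thesis using 1 d' by simp
    next
      case 2
      have \<sigma>: "\<sigma> b = raise k (wt b) b" using 2 by (simp add: \<sigma>_def)
      have mem: "\<sigma> b \<in> weight_basis (swap (wt b) k)"
        unfolding \<sigma> using weight_basis_raise[OF w(1,3) k] 2 w(2) by (simp add: d_def)
      have wt': "wt (\<sigma> b) = swap (wt b) k" using wt_eq[OF sw mem] .
      have d': "d (\<sigma> b) = - d b" by (simp add: d_def wt')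
      have pos: "1 - 1 / (d b)\<^sup>2 > 0" using 2 by (intro one_minus_inverse_square_pos) simp
      have "\<sigma> (\<sigma> b) = b"
        using 2 d' lower_raise[OF k, of "wt b" b] wt' by (simp add: \<sigma>_def[of "\<sigma> b"]) (simp add: \<sigma> d_def)
      moreover have "\<sigma> b \<in> ?B" using mem sw by (auto simp: seminormal_basis_def)
      moreover have "S k b = (1 / d b) *s b + g b *s \<sigma> b"
        using 2 S_eq_lower[of k b "wt b"] pos by (simp add: g_def \<sigma> raise_def d_def)
      moreover have "g b > 0" "g (\<sigma> b) > 0"
        using 2 d' pos by (simp_all add: g_def)
      ultimately show ?thesis using 2 d' by simp
    next
      case 3
      then have "lower k (wt b) b = 0"
        using gap_ge_1(2)[OF w(1,3) nz[OF b] k] by (simp add: d_def)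
      then have "S k b = (1 / d b) *s b" using S_eq_lower[of k b "wt b"] by (simp add: d_def)
      then show ?thesis using 3 b by (auto simp: \<sigma>_def g_def)
    qed
  qed
  then show ?thesis by blast
qed


section \<open>Matrix coefficients and nonnegativity of Young subgroup sums\<close>

definition rep_coeff :: "(nat \<Rightarrow> nat) \<Rightarrow> 'v \<Rightarrow> 'v \<Rightarrow> real" where
  "rep_coeff w c b = representation seminormal_basis (act w b) c"

lemma act_seminormal_basis_in_span: "w permutes {..<n} \<Longrightarrow> b \<in> seminormal_basis \<Longrightarrow> act w b \<in> span seminormal_basis"
  using span_seminormal_basis act_closed seminormal_basis_subset by blast

lemma act_eq_sum_rep_coeff:
  "w permutes {..<n} \<Longrightarrow> b \<in> seminormal_basis \<Longrightarrow> act w b = (\<Sum>c\<in>seminormal_basis. rep_coeff w c b *s c)"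
  unfolding rep_coeff_def
  by (rule sum_representation_eq[symmetric])
    (auto simp: independent_seminormal_basis finite_seminormal_basis act_seminormal_basis_in_span)

lemma rep_coeff_comp:
  assumes "p permutes {..<n}" "q permutes {..<n}" "b \<in> seminormal_basis"
  shows "rep_coeff (p \<circ> q) c b = (\<Sum>d\<in>seminormal_basis. rep_coeff p c d * rep_coeff q d b)"
proof -
  have "act (p \<circ> q) b = (\<Sum>d\<in>seminormal_basis. rep_coeff q d b *s act p d)"
    using assms by (simp add: act_comp act_eq_sum_rep_coeff[of q b] act_sum act_scale)
  then show ?thesis using assms
    by (simp add: rep_coeff_def[of "p \<circ> q"] representation_sum independent_seminormal_basis span_scale
        act_seminormal_basis_in_span representation_scale) (simp add: rep_coeff_def mult.commute)
qed

text \<open>The matrix \<open>e\<close> of the sum absorbs each \<open>S k\<close> of the subgroup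
  on either side. In seminormal form this reads (1 - 1/d) e = g e' for entries in paired rows or
  columns, with positive factors whenever the pair is proper, so signs are constant along orbits of
  the \<open>\<sigma> k\<close>. Finally e e = |W| e, with |W| the order of the subgroup, rules out
  a negative sign.\<close>

lemma young_symmetrizer_nonneg:
  fixes a :: "nat \<Rightarrow> 'a::linorder"
  assumes a: "mono_on {..<n} a" and c: "c \<in> seminormal_basis" and b: "b \<in> seminormal_basis"
  shows "0 \<le> (\<Sum>w\<in>stab n a. rep_coeff w c b)"
proof -
  let ?B = seminormal_basis
  define e where "e c b = (\<Sum>w\<in>stab n a. rep_coeff w c b)" for c b
  define K where "K = {k. Suc k < n \<and> a k = a (Suc k)}"
  have perm: "w permutes {..<n}" if "w \<in> stab n a" for w using that by (simp add: stab_def)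
  define P where "P k \<sigma> d g \<longleftrightarrow> (\<forall>b\<in>?B. \<sigma> b \<in> ?B \<and> \<sigma> (\<sigma> b) = b \<and>
    S k b = (1 / d b) *s b + g b *s \<sigma> b \<and>
    (\<sigma> b = b \<and> g b = 0 \<and> \<bar>d b\<bar> = 1 \<or> 1 < \<bar>d b\<bar> \<and> g b > 0 \<and> d (\<sigma> b) = - d b \<and> g (\<sigma> b) > 0))" for k \<sigma> d g
  have "\<forall>k\<in>K. \<exists>\<sigma> d g. P k \<sigma> d g"
    using seminormal_form by (simp add: K_def P_def)
  then obtain \<sigma> d g where "\<And>k. k \<in> K \<Longrightarrow> P k (\<sigma> k) (d k) (g k)"
    by metis
  then have sf: "\<And>k b. k \<in> K \<Longrightarrow> b \<in> ?B \<Longrightarrow> \<sigma> k b \<in> ?B \<and> \<sigma> k (\<sigma> k b) = b \<and>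
    S k b = (1 / d k b) *s b + g k b *s \<sigma> k b \<and>
    (\<sigma> k b = b \<and> g k b = 0 \<and> \<bar>d k b\<bar> = 1 \<or> 1 < \<bar>d k b\<bar> \<and> g k b > 0 \<and> d k (\<sigma> k b) = - d k b \<and> g k (\<sigma> k b) > 0)"
    unfolding P_def by blast
  have sK: "transpose k (Suc k) \<in> stab n a" if "k \<in> K" for k
    using that by (auto simp: K_def stab_def permutes_swap_id transpose_def)
  have S_coeff: "rep_coeff (transpose k (Suc k)) c b =
      (if c = b then 1 / d k b else 0) + (if c = \<sigma> k b then g k b else 0)"
    if "k \<in> K" "b \<in> ?B" for k c b
    using sf[OF that] that(2)
    by (auto simp: rep_coeff_def representation_add representation_scale representation_basis
        independent_seminormal_basis span_base span_scale)
  have sgn_row: "sgn (e (\<sigma> k c) b) = sgn (e c b)" if k: "k \<in> K" and c: "c \<in> ?B" and b: "b \<in> ?B" for k c b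
  proof -
    have "e c b = (\<Sum>w\<in>stab n a. rep_coeff (transpose k (Suc k) \<circ> w) c b)"
      unfolding e_def
      by (rule sum.reindex_bij_betw[OF bij_betw_comp_left_stab[OF sK[OF k]], symmetric])
    also have "\<dots> = (\<Sum>x\<in>?B. rep_coeff (transpose k (Suc k)) c x * e x b)"
      unfolding e_def sum_distrib_left using k b
      by (subst sum.swap) (auto simp: rep_coeff_comp perm sK intro!: sum.cong)
    also have "\<dots> = (\<Sum>x\<in>?B. (if x = c then e c b / d k c else 0) + (if x = \<sigma> k c then g k (\<sigma> k c) * e (\<sigma> k c) b else 0))"
      using k sf c by (intro sum.cong refl) (auto simp: S_coeff algebra_simps)
    also have "\<dots> = e c b / d k c + g k (\<sigma> k c) * e (\<sigma> k c) b"
      using c sf[OF k c] by (simp add: sum.distrib finite_seminormal_basis)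
    finally have eq: "(1 - 1 / d k c) * e c b = g k (\<sigma> k c) * e (\<sigma> k c) b" by (simp add: algebra_simps)
    show ?thesis
    proof (cases "\<sigma> k c = c")
      case False
      then have "1 < \<bar>d k c\<bar>" "g k (\<sigma> k c) > 0" using sf[OF k c] by auto
      then have "1 - 1 / d k c > 0" by (auto simp: abs_if field_simps split: if_splits)
      then show ?thesis using arg_cong[OF eq, of sgn] \<open>g k (\<sigma> k c) > 0\<close> by (simp add: sgn_mult)
    qed simp
  qed
  have sgn_col: "sgn (e c (\<sigma> k b)) = sgn (e c b)" if k: "k \<in> K" and c: "c \<in> ?B" and b: "b \<in> ?B" for k c b
  proof -
    have "e c b = (\<Sum>w\<in>stab n a. rep_coeff (w \<circ> transpose k (Suc k)) c b)"
      unfolding e_def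
      by (rule sum.reindex_bij_betw[OF bij_betw_comp_right_stab[OF sK[OF k]], symmetric])
    also have "\<dots> = (\<Sum>x\<in>?B. e c x * rep_coeff (transpose k (Suc k)) x b)"
      unfolding e_def sum_distrib_right using k b
      by (subst sum.swap) (auto simp: rep_coeff_comp perm sK intro!: sum.cong)
    also have "\<dots> = (\<Sum>x\<in>?B. (if x = b then e c b / d k b else 0) + (if x = \<sigma> k b then e c (\<sigma> k b) * g k b else 0))"
      using k b by (intro sum.cong refl) (auto simp: S_coeff algebra_simps)
    also have "\<dots> = e c b / d k b + e c (\<sigma> k b) * g k b"
      using b sf[OF k b] by (simp add: sum.distrib finite_seminormal_basis)
    finally have eq: "(1 - 1 / d k b) * e c b = g k b * e c (\<sigma> k b)" by (simp add: algebra_simps)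
    show ?thesis
    proof (cases "\<sigma> k b = b")
      case False
      then have "1 < \<bar>d k b\<bar>" "g k b > 0" using sf[OF k b] by auto
      then have "1 - 1 / d k b > 0" by (auto simp: abs_if field_simps split: if_splits)
      then show ?thesis using arg_cong[OF eq, of sgn] \<open>g k b > 0\<close> by (simp add: sgn_mult)
    qed simp
  qed
  \<comment> \<open>The orbits under \<open>R\<close> decompose \<open>e\<close> into blocks: it
    vanishes between different orbits (\<open>supp_e\<close>), and inside one orbit the sign is
    constant.\<close>
  define R where "R b c \<longleftrightarrow> b \<in> ?B \<and> (\<exists>k\<in>K. c = \<sigma> k b)" for b c
  have R_row: "c \<in> ?B \<and> sgn (e c x) = sgn (e b x)" if "R\<^sup>*\<^sup>* b c" "b \<in> ?B" "x \<in> ?B" for b c x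
    using that by (induction rule: rtranclp_induct) (auto simp: R_def sf sgn_row)
  have R_col: "sgn (e x c) = sgn (e x b)" if "R\<^sup>*\<^sup>* b c" "b \<in> ?B" "x \<in> ?B" for b c x
    using that by (induction rule: rtranclp_induct) (auto simp: R_def sf sgn_col)
  have supp: "\<forall>b\<in>?B. \<forall>c. rep_coeff w c b \<noteq> 0 \<longrightarrow> R\<^sup>*\<^sup>* b c" if "w \<in> stab n a" for w
    using a that
  proof (induction w rule: stab_induct)
    case id
    then show ?case by (simp add: rep_coeff_def act_id[unfolded id_def] representation_basis independent_seminormal_basis)
  next
    case (swap w k)
    have k: "k \<in> K" using swap by (simp add: K_def)
    show ?case
    proof (clarify)
      fix b c assume b: "b \<in> ?B" and nz: "rep_coeff (w \<circ> transpose k (Suc k)) c b \<noteq> 0"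
      have "(\<Sum>x\<in>?B. rep_coeff w c x * rep_coeff (transpose k (Suc k)) x b) \<noteq> 0"
        using nz rep_coeff_comp[OF perm[OF swap(1)] perm[OF sK[OF k]] b, of c] by simp
      then obtain x where x: "x \<in> ?B" "rep_coeff w c x \<noteq> 0" "rep_coeff (transpose k (Suc k)) x b \<noteq> 0"
        by (rule sum.not_neutral_contains_not_neutral) auto
      have "x = b \<or> R b x" using x(3) S_coeff[OF k b, of x] b k by (auto simp: R_def split: if_splits)
      then show "R\<^sup>*\<^sup>* b c" using swap.IH x by (auto intro: converse_rtranclp_into_rtranclp)
    qed
  qed
  have supp_e: "R\<^sup>*\<^sup>* b c" if "e c b \<noteq> 0" "b \<in> ?B" for b c
  proof -
    obtain w where "w \<in> stab n a" "rep_coeff w c b \<noteq> 0"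
      using \<open>e c b \<noteq> 0\<close> unfolding e_def by (rule sum.not_neutral_contains_not_neutral)
    then show ?thesis using supp \<open>b \<in> ?B\<close> by blast
  qed
  have "0 \<le> e c b"
  proof (rule ccontr)
    assume neg: "\<not> 0 \<le> e c b"
    then have bc: "R\<^sup>*\<^sup>* b c" using supp_e b by auto
    \<comment> \<open>A nonzero \<open>e x b\<close> puts \<open>x\<close> into the orbit of
      \<open>b\<close> and \<open>c\<close>, so both factors are negative like \<open>e c b\<close>;
      summing over \<open>x\<close> gives |W| times \<open>e c b\<close>, a contradiction.\<close>
    have "0 \<le> e c x * e x b" if x: "x \<in> ?B" for x
    proof (cases "e x b = 0")
      case False
      then have bx: "R\<^sup>*\<^sup>* b x" using supp_e b by auto
      have "sgn (e x b) = sgn (e c b)" using R_row[OF bx b b] R_row[OF bc b b] by simp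
      moreover have "sgn (e c x) = sgn (e c b)" using R_col[OF bx b c] .
      ultimately have "e x b < 0" "e c x < 0" using neg by (auto simp: sgn_if split: if_splits)
      then show ?thesis by (simp add: mult_neg_neg less_imp_le)
    qed simp
    then have "0 \<le> (\<Sum>x\<in>?B. e c x * e x b)" by (simp add: sum_nonneg)
    also have "\<dots> = (\<Sum>x\<in>?B. \<Sum>v\<in>stab n a. \<Sum>w\<in>stab n a. rep_coeff v c x * rep_coeff w x b)"
      by (simp add: e_def sum_product)
    also have "\<dots> = (\<Sum>v\<in>stab n a. \<Sum>x\<in>?B. \<Sum>w\<in>stab n a. rep_coeff v c x * rep_coeff w x b)"
      by (rule sum.swap)
    also have "\<dots> = (\<Sum>v\<in>stab n a. \<Sum>w\<in>stab n a. \<Sum>x\<in>?B. rep_coeff v c x * rep_coeff w x b)"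
      by (intro sum.cong refl sum.swap)
    also have "\<dots> = (\<Sum>v\<in>stab n a. \<Sum>w\<in>stab n a. rep_coeff (v \<circ> w) c b)"
      using b by (intro sum.cong refl) (simp add: rep_coeff_comp perm)
    also have "\<dots> = (\<Sum>v\<in>stab n a. e c b)"
      unfolding e_def by (intro sum.cong refl sum.reindex_bij_betw bij_betw_comp_left_stab)
    also have "\<dots> = card (stab n a) * e c b" by simp
    finally have "0 \<le> card (stab n a) * e c b" .
    then show False using neg card_stab_pos[of n a] by (simp add: zero_le_mult_iff)
  qed
  then show ?thesis by (simp add: e_def)
qed

end

subsection \<open>Products of monotone matrices\<close>

lemma q_nonneg_0 [simp]: "q_nonneg 0" and q_nonneg_1 [simp]: "q_nonneg 1"
  by (simp_all add: q_nonneg_def)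

lemma q_nonneg_add: "q_nonneg p \<Longrightarrow> q_nonneg r \<Longrightarrow> q_nonneg (p + r)"
  by (simp add: q_nonneg_def)

lemma q_nonneg_mult: "q_nonneg p \<Longrightarrow> q_nonneg r \<Longrightarrow> q_nonneg (p * r)"
  by (auto simp: q_nonneg_def coeff_mult intro!: sum_nonneg mult_nonneg_nonneg)

lemma q_nonneg_smult: "0 \<le> k \<Longrightarrow> q_nonneg p \<Longrightarrow> q_nonneg (Polynomial.smult k p)"
  by (simp add: q_nonneg_def)

lemma q_nonneg_smult_cancel: "0 < k \<Longrightarrow> q_nonneg (Polynomial.smult k p) \<Longrightarrow> q_nonneg p"
  by (simp add: q_nonneg_def zero_le_mult_iff)

lemma q_nonneg_if: "q_nonneg p \<Longrightarrow> q_nonneg r \<Longrightarrow> q_nonneg (if P then p else r)"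
  by simp

lemma q_nonneg_sum: "(\<And>i. i \<in> I \<Longrightarrow> q_nonneg (f i)) \<Longrightarrow> q_nonneg (\<Sum>i\<in>I. f i)"
  by (induction I rule: infinite_finite_induct) (auto intro: q_nonneg_add)

lemma q_nonneg_prod: "(\<And>i. i \<in> I \<Longrightarrow> q_nonneg (f i)) \<Longrightarrow> q_nonneg (\<Prod>i\<in>I. f i)"
  by (induction I rule: infinite_finite_induct) (auto intro: q_nonneg_mult)

lemma smult_sum_right: "Polynomial.smult k (\<Sum>i\<in>I. f i) = (\<Sum>i\<in>I. Polynomial.smult k (f i))"
  by (induction I rule: infinite_finite_induct) (auto simp: smult_add_right)

lemma exists_sorting_permutation:
  fixes f :: "nat \<Rightarrow> 'a::linorder"
  shows "\<exists>p. p permutes {..<n} \<and> mono_on {..<n} (f \<circ> p)"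
proof -
  let ?xs = "map f [0..<n]"
  obtain p where p: "p permutes {..<length ?xs}" "permute_list p ?xs = sort ?xs"
    using mset_eq_permutation[of "sort ?xs" ?xs] by auto
  then have p': "p permutes {..<n}" by simp
  have "sort ?xs = map (f \<circ> p) [0..<n]"
    unfolding p(2)[symmetric] using permutes_less[OF p'] by (auto simp: permute_list_def)
  then have "sorted (map (f \<circ> p) [0..<n])" by (metis sorted_sort)
  then show ?thesis using p' by (auto simp: sorted_iff_nth_mono mono_on_def intro!: exI[of _ p])
qed

text \<open>The coefficient of \<open>w\<close> in the group algebra element of the submatrix with
  rows \<open>a\<close> and columns \<open>b\<close>; repeated indices are allowed.\<close>

definition matching_weight :: "nat \<Rightarrow> (nat \<Rightarrow> nat) \<Rightarrow> (nat \<Rightarrow> nat) \<Rightarrow> (nat \<Rightarrow> nat \<Rightarrow> 'c::comm_monoid_mult) \<Rightarrow> (nat \<Rightarrow> nat) \<Rightarrow> 'c" where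
  "matching_weight n a b M w = (\<Prod>i<n. M (a i) (b (w i)))"

text \<open>Any two positions of the support are comparable; in equal rows they are so
  automatically.\<close>

definition monotone_support :: "(nat \<Rightarrow> nat \<Rightarrow> 'c::zero) \<Rightarrow> bool" where
  "monotone_support M \<longleftrightarrow> (\<forall>i j i' j'. M i j \<noteq> 0 \<longrightarrow> M i' j' \<noteq> 0 \<longrightarrow> i < i' \<longrightarrow> j \<le> j')"

text \<open>
  The pairs \<open>(a i, b (w i))\<close> of a matching of non-zero weight form a chain, so that sorting them
  yields \<open>(a i, b i)\<close>.
\<close>

lemma matching_factorization:
  fixes M :: "nat \<Rightarrow> nat \<Rightarrow> 'c::semidom"
  assumes M: "monotone_support M" and a: "mono_on {..<n} a" and b: "mono_on {..<n} b"
    and w: "w permutes {..<n}" and nz: "matching_weight n a b M w \<noteq> 0"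
  shows "\<exists>v\<in>stab n b. \<exists>u\<in>stab n a. w = v \<circ> u"
proof -
  \<comment> \<open>On a chain the coordinate sum is strictly increasing, so sorting by it sorts
    both coordinates at once.\<close>
  obtain p where p: "p permutes {..<n}" "mono_on {..<n} ((\<lambda>i. a i + b (w i)) \<circ> p)"
    using exists_sorting_permutation by blast
  have nz': "M (a i) (b (w i)) \<noteq> 0" if "i < n" for i
    using nz that by (auto simp: matching_weight_def)
  have "a (p i) \<le> a (p j) \<and> b (w (p i)) \<le> b (w (p j))" if "i \<le> j" "j < n" for i j
  proof -
    have "p i < n" "p j < n" using that permutes_less[OF p(1)] by auto
    then have "M (a (p i)) (b (w (p i))) \<noteq> 0" "M (a (p j)) (b (w (p j))) \<noteq> 0" using nz' by auto
    then have "a (p i) < a (p j) \<Longrightarrow> b (w (p i)) \<le> b (w (p j))" "a (p j) < a (p i) \<Longrightarrow> b (w (p j)) \<le> b (w (p i))"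
      using M unfolding monotone_support_def by blast+
    moreover have "a (p i) + b (w (p i)) \<le> a (p j) + b (w (p j))"
      using p(2) that by (simp add: mono_on_def)
    ultimately show ?thesis by linarith
  qed
  then have "mono_on {..<n} (a \<circ> p)" "mono_on {..<n} (b \<circ> (w \<circ> p))"
    by (auto simp: mono_on_def)
  then have "p \<in> stab n a" "w \<circ> p \<in> stab n b"
    using mono_rearrangement_unique[OF a _ p(1)] mono_rearrangement_unique[OF b, of "w \<circ> p"] p(1) w
    by (auto simp: stab_def permutes_compose)
  moreover have "w = (w \<circ> p) \<circ> Hilbert_Choice.inv p" using comp_permutes_inv[OF p(1)] by simp
  ultimately show ?thesis using inv_in_stab by blast
qed

lemma matching_weight_invariant:
  assumes u: "u \<in> stab n a" and v: "v \<in> stab n b" and w: "w permutes {..<n}"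
  shows "matching_weight n a b M (v \<circ> w \<circ> u) = matching_weight n a b M w"
proof -
  have "matching_weight n a b M (v \<circ> w \<circ> u) = (\<Prod>i<n. M (a (u i)) (b (w (u i))))"
    unfolding matching_weight_def using u v w
    by (intro prod.cong refl) (simp add: stab_def permutes_less)
  also have "\<dots> = (\<Prod>i<n. M (a i) (b (w i)))"
    by (rule prod.reindex_bij_betw[OF permutes_imp_bij[OF stab_permutes[OF u]], of "\<lambda>i. M (a i) (b (w i))"])
  finally show ?thesis by (simp add: matching_weight_def)
qed

abbreviation perms :: "nat \<Rightarrow> (nat \<Rightarrow> nat) set" where
  "perms n \<equiv> {w. w permutes {..<n}}"

lemma perms_eq_stab: "perms n = stab n (\<lambda>_. ())"
  by (simp add: stab_def)

lemma sum_perms_left: "u \<in> perms n \<Longrightarrow> (\<Sum>w\<in>perms n. f (u \<circ> w)) = (\<Sum>w\<in>perms n. f w)"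
  unfolding perms_eq_stab by (rule sum.reindex_bij_betw[OF bij_betw_comp_left_stab])

lemma sum_perms_right: "u \<in> perms n \<Longrightarrow> (\<Sum>w\<in>perms n. f (w \<circ> u)) = (\<Sum>w\<in>perms n. f w)"
  unfolding perms_eq_stab by (rule sum.reindex_bij_betw[OF bij_betw_comp_right_stab])

lemma sum_stab_left: "u \<in> stab n a \<Longrightarrow> (\<Sum>w\<in>stab n a. f (u \<circ> w)) = (\<Sum>w\<in>stab n a. f w)"
  by (rule sum.reindex_bij_betw[OF bij_betw_comp_left_stab])

lemma sum_stab_right: "u \<in> stab n a \<Longrightarrow> (\<Sum>w\<in>stab n a. f (w \<circ> u)) = (\<Sum>w\<in>stab n a. f w)"
  by (rule sum.reindex_bij_betw[OF bij_betw_comp_right_stab])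

text \<open>The interface between representations and matrices: only a composition law and the sign
  of Young subgroup sums pass through it.\<close>

locale positive_sym_rep =
  fixes n :: nat and B :: "'b set" and \<rho> :: "(nat \<Rightarrow> nat) \<Rightarrow> 'b \<Rightarrow> 'b \<Rightarrow> real"
  assumes finite_B: "finite B"
    and rho_comp: "p permutes {..<n} \<Longrightarrow> q permutes {..<n} \<Longrightarrow> c \<in> B \<Longrightarrow> b \<in> B \<Longrightarrow>
      \<rho> (p \<circ> q) c b = (\<Sum>d\<in>B. \<rho> p c d * \<rho> q d b)"
    and rho_young: "mono_on {..<n} (a :: nat \<Rightarrow> nat) \<Longrightarrow> c \<in> B \<Longrightarrow> b \<in> B \<Longrightarrow> 0 \<le> (\<Sum>w\<in>stab n a. \<rho> w c b)"
begin

definition entry :: "((nat \<Rightarrow> nat) \<Rightarrow> real poly) \<Rightarrow> 'b \<Rightarrow> 'b \<Rightarrow> real poly" where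
  "entry x c b = (\<Sum>w\<in>perms n. Polynomial.smult (\<rho> w c b) (x w))"

definition nonneg_element :: "((nat \<Rightarrow> nat) \<Rightarrow> real poly) \<Rightarrow> bool" where
  "nonneg_element x \<longleftrightarrow> (\<forall>c\<in>B. \<forall>b\<in>B. q_nonneg (entry x c b))"

text \<open>The bounds cut infinite matrices to finite ones so that products are finite sums; index
  maps are weakly monotone because the intermediate indices of a product repeat.\<close>

definition nonneg_matrix :: "nat \<Rightarrow> nat \<Rightarrow> (nat \<Rightarrow> nat \<Rightarrow> real poly) \<Rightarrow> bool" where
  "nonneg_matrix R S M \<longleftrightarrow> (\<forall>a b. mono_on {..<n} a \<longrightarrow> mono_on {..<n} b \<longrightarrow> (\<forall>i<n. a i < R \<and> b i < S) \<longrightarrow>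
     nonneg_element (matching_weight n a b M))"

text \<open>The weight is constant on the double cosets of the two stabilizers, and where it is
  nonzero \<open>w\<close> lies in the double coset of the identity. There the sum of
  \<open>\<rho> (v \<circ> w \<circ> u)\<close> over both stabilizers is an entry of a product of
  two nonnegative matrices.\<close>

lemma nonneg_element_matching_weight:
  assumes M: "monotone_support M" and Mpos: "\<And>i j. q_nonneg (M i j)"
    and a: "mono_on {..<n} a" and b: "mono_on {..<n} b"
  shows "nonneg_element (matching_weight n a b M)"
  unfolding nonneg_element_def
proof (intro ballI)
  fix c d assume c: "c \<in> B" and d: "d \<in> B"
  let ?x = "matching_weight n a b M"
  let ?Sa = "stab n a" and ?Sb = "stab n b"
  have shift: "entry ?x c d = (\<Sum>w\<in>perms n. Polynomial.smult (\<rho> (v \<circ> w \<circ> u) c d) (?x w))"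
    if u: "u \<in> ?Sa" and v: "v \<in> ?Sb" for u v
  proof -
    have up: "u \<in> perms n" "v \<in> perms n" using u v by (auto simp: stab_def)
    have "entry ?x c d = (\<Sum>w\<in>perms n. Polynomial.smult (\<rho> (v \<circ> w \<circ> u) c d) (?x (v \<circ> w \<circ> u)))"
      unfolding entry_def
      using sum_perms_right[OF up(1), of "\<lambda>w. Polynomial.smult (\<rho> w c d) (?x w)"]
        sum_perms_left[OF up(2), of "\<lambda>w. Polynomial.smult (\<rho> (w \<circ> u) c d) (?x (w \<circ> u))"] by simp
    also have "\<dots> = (\<Sum>w\<in>perms n. Polynomial.smult (\<rho> (v \<circ> w \<circ> u) c d) (?x w))"
      using matching_weight_invariant[OF u v, where M = M] by (intro sum.cong refl) simp
    finally show ?thesis .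
  qed
  have "Polynomial.smult (card ?Sa * card ?Sb) (entry ?x c d) = (\<Sum>u\<in>?Sa. \<Sum>v\<in>?Sb. entry ?x c d)"
    by (simp add: of_nat_poly mult.commute)
  also have "\<dots> = (\<Sum>u\<in>?Sa. \<Sum>v\<in>?Sb. \<Sum>w\<in>perms n. Polynomial.smult (\<rho> (v \<circ> w \<circ> u) c d) (?x w))"
    by (intro sum.cong refl shift)
  also have "\<dots> = (\<Sum>u\<in>?Sa. \<Sum>w\<in>perms n. \<Sum>v\<in>?Sb. Polynomial.smult (\<rho> (v \<circ> w \<circ> u) c d) (?x w))"
    by (intro sum.cong refl sum.swap)
  also have "\<dots> = (\<Sum>w\<in>perms n. \<Sum>u\<in>?Sa. \<Sum>v\<in>?Sb. Polynomial.smult (\<rho> (v \<circ> w \<circ> u) c d) (?x w))"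
    by (rule sum.swap)
  also have "\<dots> = (\<Sum>w\<in>perms n. Polynomial.smult (\<Sum>u\<in>?Sa. \<Sum>v\<in>?Sb. \<rho> (v \<circ> w \<circ> u) c d) (?x w))"
    by (simp add: smult_sum)
  finally have eq: "Polynomial.smult (card ?Sa * card ?Sb) (entry ?x c d) =
    (\<Sum>w\<in>perms n. Polynomial.smult (\<Sum>u\<in>?Sa. \<Sum>v\<in>?Sb. \<rho> (v \<circ> w \<circ> u) c d) (?x w))" .
  have "q_nonneg (Polynomial.smult (\<Sum>u\<in>?Sa. \<Sum>v\<in>?Sb. \<rho> (v \<circ> w \<circ> u) c d) (?x w))" if w: "w \<in> perms n" for w
  proof (cases "?x w = 0")
    case False
    then obtain v0 u0 where uv: "v0 \<in> ?Sb" "u0 \<in> ?Sa" "w = v0 \<circ> u0"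
      using matching_factorization[OF M a b] w by blast
    have "(\<Sum>u\<in>?Sa. \<Sum>v\<in>?Sb. \<rho> (v \<circ> w \<circ> u) c d) = (\<Sum>u\<in>?Sa. \<Sum>v\<in>?Sb. \<rho> (v \<circ> v0 \<circ> (u0 \<circ> u)) c d)"
      by (simp add: uv comp_assoc)
    also have "\<dots> = (\<Sum>u\<in>?Sa. \<Sum>v\<in>?Sb. \<rho> (v \<circ> (u0 \<circ> u)) c d)"
      using sum_stab_right[OF uv(1), of "\<lambda>v. \<rho> (v \<circ> (u0 \<circ> _)) c d"] by (rule sum.cong[OF refl])
    also have "\<dots> = (\<Sum>u\<in>?Sa. \<Sum>v\<in>?Sb. \<rho> (v \<circ> u) c d)"
      by (rule sum_stab_left[OF uv(2)])
    also have "\<dots> = (\<Sum>u\<in>?Sa. \<Sum>v\<in>?Sb. \<Sum>e\<in>B. \<rho> v c e * \<rho> u e d)"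
      using c d by (intro sum.cong refl rho_comp) (auto simp: stab_def)
    also have "\<dots> = (\<Sum>u\<in>?Sa. \<Sum>e\<in>B. \<Sum>v\<in>?Sb. \<rho> v c e * \<rho> u e d)"
      by (intro sum.cong refl sum.swap)
    also have "\<dots> = (\<Sum>e\<in>B. \<Sum>u\<in>?Sa. \<Sum>v\<in>?Sb. \<rho> v c e * \<rho> u e d)"
      by (rule sum.swap)
    also have "\<dots> = (\<Sum>e\<in>B. (\<Sum>u\<in>?Sa. \<rho> u e d) * (\<Sum>v\<in>?Sb. \<rho> v c e))"
      by (simp add: sum_product mult.commute)
    also have "\<dots> \<ge> 0"
      by (rule sum_nonneg) (intro mult_nonneg_nonneg rho_young a b c d; assumption)
    finally show ?thesis
      using Mpos by (intro q_nonneg_smult) (auto simp: matching_weight_def intro: q_nonneg_prod)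
  qed simp
  then have "q_nonneg (Polynomial.smult (card ?Sa * card ?Sb) (entry ?x c d))"
    unfolding eq by (rule q_nonneg_sum)
  moreover have "0 < real (card ?Sa * card ?Sb)"
    by (simp add: card_stab_pos)
  ultimately show "q_nonneg (entry ?x c d)" by (rule q_nonneg_smult_cancel[rotated])
qed

lemma nonneg_matrix_monotone_support:
  "monotone_support M \<Longrightarrow> (\<And>i j. q_nonneg (M i j)) \<Longrightarrow> nonneg_matrix R S M"
  by (simp add: nonneg_matrix_def nonneg_element_matching_weight)

text \<open>An entry of the product \<open>y\<close> times \<open>x\<close> in the group algebra:
  \<open>u\<close> leads from rows to intermediate positions and \<open>v\<close> from there to
  columns, hence \<open>v \<circ> u\<close>.\<close>

definition convolution :: "((nat \<Rightarrow> nat) \<Rightarrow> real poly) \<Rightarrow> ((nat \<Rightarrow> nat) \<Rightarrow> real poly) \<Rightarrow> 'b \<Rightarrow> 'b \<Rightarrow> real poly" where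
  "convolution x y c b = (\<Sum>u\<in>perms n. \<Sum>v\<in>perms n. Polynomial.smult (\<rho> (v \<circ> u) c b) (x u * y v))"

lemma convolution_nonneg:
  assumes "nonneg_element x" "nonneg_element y" "c \<in> B" "b \<in> B"
  shows "q_nonneg (convolution x y c b)"
proof -
  have "convolution x y c b = (\<Sum>u\<in>perms n. \<Sum>v\<in>perms n. \<Sum>d\<in>B.
      Polynomial.smult (\<rho> u d b) (x u) * Polynomial.smult (\<rho> v c d) (y v))"
    unfolding convolution_def using assms
    by (intro sum.cong refl) (simp add: rho_comp smult_sum mult.commute)
  also have "\<dots> = (\<Sum>u\<in>perms n. \<Sum>d\<in>B. \<Sum>v\<in>perms n.
      Polynomial.smult (\<rho> u d b) (x u) * Polynomial.smult (\<rho> v c d) (y v))"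
    by (intro sum.cong refl sum.swap)
  also have "\<dots> = (\<Sum>d\<in>B. \<Sum>u\<in>perms n. \<Sum>v\<in>perms n.
      Polynomial.smult (\<rho> u d b) (x u) * Polynomial.smult (\<rho> v c d) (y v))"
    by (rule sum.swap)
  also have "\<dots> = (\<Sum>d\<in>B. entry x d b * entry y c d)"
    unfolding entry_def by (simp only: sum_product)
  finally show ?thesis using assms
    by (auto simp: nonneg_element_def intro!: q_nonneg_sum q_nonneg_mult)
qed

text \<open>Relabelling the intermediate positions replaces \<open>u\<close> by
  \<open>Hilbert_Choice.inv p \<circ> u\<close> and \<open>v\<close> by \<open>v \<circ> p\<close>,
  which cancel in \<open>v \<circ> u\<close>; so intermediate indices may be sorted.\<close>

lemma convolution_reindex:
  assumes p: "p permutes {..<n}"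
  shows "convolution (matching_weight n a f M) (matching_weight n f b N) c d =
    convolution (matching_weight n a (f \<circ> p) M) (matching_weight n (f \<circ> p) b N) c d"
proof -
  let ?q = "Hilbert_Choice.inv p"
  have q: "?q \<in> perms n" "p \<in> perms n" using p by (simp_all add: permutes_inv)
  have 1: "matching_weight n a (f \<circ> p) M (?q \<circ> u) = matching_weight n a f M u" for u
    unfolding matching_weight_def by (simp add: permutes_inverses(1)[OF p])
  have 2: "matching_weight n (f \<circ> p) b N (v \<circ> p) = matching_weight n f b N v" for v
    unfolding matching_weight_def
    using prod.reindex_bij_betw[OF permutes_imp_bij[OF p], of "\<lambda>i. N (f i) (b (v i))"] by simp
  have 3: "v \<circ> p \<circ> (?q \<circ> u) = v \<circ> u" for u v by (simp add: fun_eq_iff permutes_inverses(1)[OF p])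
  have "convolution (matching_weight n a (f \<circ> p) M) (matching_weight n (f \<circ> p) b N) c d =
    (\<Sum>u\<in>perms n. \<Sum>v\<in>perms n. Polynomial.smult (\<rho> (v \<circ> u) c d)
      (matching_weight n a (f \<circ> p) M u * matching_weight n (f \<circ> p) b N v))"
    by (simp add: convolution_def)
  also have "\<dots> = (\<Sum>u\<in>perms n. \<Sum>v\<in>perms n. Polynomial.smult (\<rho> (v \<circ> (?q \<circ> u)) c d)
      (matching_weight n a (f \<circ> p) M (?q \<circ> u) * matching_weight n (f \<circ> p) b N v))"
    by (rule sum_perms_left[OF q(1), symmetric])
  also have "\<dots> = (\<Sum>u\<in>perms n. \<Sum>v\<in>perms n. Polynomial.smult (\<rho> (v \<circ> p \<circ> (?q \<circ> u)) c d)
      (matching_weight n a (f \<circ> p) M (?q \<circ> u) * matching_weight n (f \<circ> p) b N (v \<circ> p)))"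
    by (intro sum.cong refl sum_perms_right[OF q(2), symmetric])
  finally show ?thesis by (simp only: 1 2 3 convolution_def)
qed

text \<open>
  A Cauchy-Binet formula. Averaging over all orderings \<open>z\<close> of the intermediate indices avoids
  dividing by the order of the stabilizer of each multiset of indices.
\<close>

lemma cauchy_binet:
  fixes M N :: "nat \<Rightarrow> nat \<Rightarrow> real poly"
  shows "Polynomial.smult (card (perms n)) (entry (matching_weight n a b (\<lambda>i j. \<Sum>k<K. M i k * N k j)) c d) =
    (\<Sum>f\<in>PiE {..<n} (\<lambda>_. {..<K}). convolution (matching_weight n a f M) (matching_weight n f b N) c d)"
proof -
  let ?F = "PiE {..<n} (\<lambda>_. {..<K})"
  let ?x = "matching_weight n a b (\<lambda>i j. \<Sum>k<K. M i k * N k j)"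
  have x: "?x (v \<circ> z) = (\<Sum>f\<in>?F. matching_weight n a f M z * matching_weight n f b N v)"
    if z: "z \<in> perms n" for v z
  proof -
    have zp: "z permutes {..<n}" using z by simp
    have bij: "bij_betw (\<lambda>f. f \<circ> z) ?F ?F"
    proof (rule bij_betw_byWitness[where f' = "\<lambda>f. f \<circ> Hilbert_Choice.inv z"])
      have *: "f \<circ> q \<in> ?F" if "q permutes {..<n}" "f \<in> ?F" for q and f :: "nat \<Rightarrow> nat"
        using that permutes_less[OF that(1)] by (auto simp: PiE_iff extensional_def permutes_def)
      show "(\<lambda>f. f \<circ> z) ` ?F \<subseteq> ?F" using *[OF zp] by blast
      show "(\<lambda>f. f \<circ> Hilbert_Choice.inv z) ` ?F \<subseteq> ?F" using *[OF permutes_inv[OF zp]] by blast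
    qed (simp_all add: comp_permutes_inv[OF zp])
    have "?x (v \<circ> z) = (\<Sum>f\<in>?F. \<Prod>i<n. M (a i) (f i) * N (f i) (b (v (z i))))"
      unfolding matching_weight_def by (simp add: prod_sum_PiE)
    also have "\<dots> = (\<Sum>f\<in>?F. \<Prod>i<n. M (a i) (f (z i)) * N (f (z i)) (b (v (z i))))"
      using sum.reindex_bij_betw[OF bij, of "\<lambda>f. \<Prod>i<n. M (a i) (f i) * N (f i) (b (v (z i)))"] by simp
    also have "\<dots> = (\<Sum>f\<in>?F. matching_weight n a f M z * matching_weight n f b N v)"
      unfolding matching_weight_def prod.distrib
      using prod.reindex_bij_betw[OF permutes_imp_bij[OF zp], of "\<lambda>i. N (_ i) (b (v i))"] by simp
    finally show ?thesis .
  qed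
  have "Polynomial.smult (card (perms n)) (entry ?x c d) = (\<Sum>z\<in>perms n. entry ?x c d)"
    by (simp add: of_nat_poly)
  also have "\<dots> = (\<Sum>z\<in>perms n. \<Sum>v\<in>perms n. Polynomial.smult (\<rho> (v \<circ> z) c d) (?x (v \<circ> z)))"
    unfolding entry_def by (intro sum.cong refl sum_perms_right[symmetric])
  also have "\<dots> = (\<Sum>z\<in>perms n. \<Sum>v\<in>perms n. \<Sum>f\<in>?F.
      Polynomial.smult (\<rho> (v \<circ> z) c d) (matching_weight n a f M z * matching_weight n f b N v))"
    by (intro sum.cong refl) (simp add: x smult_sum_right)
  also have "\<dots> = (\<Sum>z\<in>perms n. \<Sum>f\<in>?F. \<Sum>v\<in>perms n.
      Polynomial.smult (\<rho> (v \<circ> z) c d) (matching_weight n a f M z * matching_weight n f b N v))"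
    by (intro sum.cong refl sum.swap)
  also have "\<dots> = (\<Sum>f\<in>?F. convolution (matching_weight n a f M) (matching_weight n f b N) c d)"
    unfolding convolution_def by (rule sum.swap)
  finally show ?thesis .
qed

lemma nonneg_matrix_mult:
  assumes M: "nonneg_matrix R K M" and N: "nonneg_matrix K S N"
  shows "nonneg_matrix R S (\<lambda>i j. \<Sum>k<K. M i k * N k j)"
  unfolding nonneg_matrix_def nonneg_element_def
proof (intro allI impI ballI)
  fix a b c d
  assume a: "mono_on {..<n} a" and b: "mono_on {..<n} b" and ab: "\<forall>i<n. a i < R \<and> b i < S"
    and c: "c \<in> B" and d: "d \<in> B"
  let ?x = "matching_weight n a b (\<lambda>i j. \<Sum>k<K. M i k * N k j)"
  have "q_nonneg (convolution (matching_weight n a f M) (matching_weight n f b N) c d)"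
    if f: "f \<in> PiE {..<n} (\<lambda>_. {..<K})" for f
  proof -
    obtain p where p: "p permutes {..<n}" "mono_on {..<n} (f \<circ> p)"
      using exists_sorting_permutation by blast
    have "f (p i) < K" if "i < n" for i using f permutes_less[OF p(1) that] by (auto simp: PiE_iff)
    then have "nonneg_element (matching_weight n a (f \<circ> p) M)" "nonneg_element (matching_weight n (f \<circ> p) b N)"
      using M N a b ab p(2) by (auto simp: nonneg_matrix_def)
    then show ?thesis using convolution_nonneg[OF _ _ c d] convolution_reindex[OF p(1), of a f M b N c d] by simp
  qed
  then have "q_nonneg (Polynomial.smult (card (perms n)) (entry ?x c d))"
    unfolding cauchy_binet by (rule q_nonneg_sum)
  moreover have "0 < real (card (perms n))"
    unfolding perms_eq_stab by (simp add: card_stab_pos)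
  ultimately show "q_nonneg (entry ?x c d)" by (rule q_nonneg_smult_cancel[rotated])
qed

lemma nonneg_matrix_cong:
  assumes "nonneg_matrix R S M" "\<And>i j. i < R \<Longrightarrow> j < S \<Longrightarrow> M i j = N i j"
  shows "nonneg_matrix R S N"
  unfolding nonneg_matrix_def
proof (intro allI impI)
  fix a b :: "nat \<Rightarrow> nat"
  assume a: "mono_on {..<n} a" and b: "mono_on {..<n} b" and ab: "\<forall>i<n. a i < R \<and> b i < S"
  have "entry (matching_weight n a b N) = entry (matching_weight n a b M)"
    unfolding entry_def matching_weight_def using ab assms(2)
    by (intro ext sum.cong refl arg_cong2[of _ _ _ _ Polynomial.smult] prod.cong) (simp add: permutes_less)
  then show "nonneg_element (matching_weight n a b N)"
    using assms(1) a b ab by (auto simp: nonneg_matrix_def nonneg_element_def)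
qed

end

subsection \<open>Catalan-Stieltjes and Hankel matrices\<close>

definition tridiagonal :: "(nat \<Rightarrow> real poly) \<Rightarrow> (nat \<Rightarrow> real poly) \<Rightarrow> (nat \<Rightarrow> real poly) \<Rightarrow> nat \<Rightarrow> nat \<Rightarrow> real poly" where
  "tridiagonal r s t k l = (if l = k then s k else 0) + (if l = Suc k then r k else 0) + (if Suc l = k then t k else 0)"

text \<open>Row \<open>n\<close> ends at column \<open>n\<close>, so every cut-off beyond
  \<open>n\<close> gives the full recurrence.\<close>

lemma catalan_stieltjes_Suc:
  assumes "n < K"
  shows "catalan_stieltjes r s t (Suc n) j = (\<Sum>l<K. catalan_stieltjes r s t n l * tridiagonal r s t l j)"
proof -
  let ?C = "catalan_stieltjes r s t"
  have 1: "(\<Sum>l<K. if j = l then ?C n l * s l else 0) = s j * ?C n j"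
    using assms catalan_stieltjes_lower_triangular[of n j r s t] by simp
  have 2: "(\<Sum>l<K. if j = Suc l then ?C n l * r l else 0) = (case j of 0 \<Rightarrow> 0 | Suc i \<Rightarrow> r i * ?C n i)"
    using assms catalan_stieltjes_lower_triangular[of n "j - 1" r s t] by (cases j) auto
  have 3: "(\<Sum>l<K. if Suc j = l then ?C n l * t l else 0) = t (Suc j) * ?C n (Suc j)"
    using assms catalan_stieltjes_lower_triangular[of n "Suc j" r s t] by simp
  have "(\<Sum>l<K. ?C n l * tridiagonal r s t l j) =
    (\<Sum>l<K. (if j = l then ?C n l * s l else 0) + (if j = Suc l then ?C n l * r l else 0) + (if Suc j = l then ?C n l * t l else 0))"
    by (intro sum.cong refl) (simp add: tridiagonal_def algebra_simps)
  also have "\<dots> = ?C (Suc n) j"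
    unfolding sum.distrib 1 2 3 by (cases j) simp_all
  finally show ?thesis by simp
qed

text \<open>With J the tridiagonal matrix, the entry is the corner of J^(i+j), that is, row 0 of J^i
  times column 0 of J^j, and the latter is a row for the transpose of J. The induction moves one J
  at a time to the left; the index shifts occur because \<open>t\<close> starts at 1.\<close>

lemma hankel_matrix_factorization:
  assumes "i + j < K"
  shows "hankel_matrix r s t i j =
    (\<Sum>k<K. catalan_stieltjes r s t i k * catalan_stieltjes (\<lambda>k. t (Suc k)) s (\<lambda>k. r (k - 1)) j k)"
  using assms
proof (induction j arbitrary: i)
  case 0
  have "(\<Sum>k<K. catalan_stieltjes r s t i k * catalan_stieltjes (\<lambda>k. t (Suc k)) s (\<lambda>k. r (k - 1)) 0 k) =
    (\<Sum>k<K. if k = 0 then catalan_stieltjes r s t i 0 else 0)"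
    by (intro sum.cong refl) (auto simp: gr0_conv_Suc)
  then show ?case using 0 by (simp add: hankel_matrix_def)
next
  case (Suc j)
  let ?C = "catalan_stieltjes r s t" and ?D = "catalan_stieltjes (\<lambda>k. t (Suc k)) s (\<lambda>k. r (k - 1))"
  have transpose: "tridiagonal (\<lambda>k. t (Suc k)) s (\<lambda>k. r (k - 1)) l k = tridiagonal r s t k l" for k l
    by (auto simp: tridiagonal_def)
  have "(\<Sum>k<K. ?C i k * ?D (Suc j) k) = (\<Sum>k<K. \<Sum>l<K. ?C i k * (?D j l * tridiagonal r s t k l))"
    using Suc.prems by (simp add: catalan_stieltjes_Suc[of j K] transpose[unfolded One_nat_def] sum_distrib_left)
  also have "\<dots> = (\<Sum>l<K. \<Sum>k<K. ?C i k * (?D j l * tridiagonal r s t k l))"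
    by (rule sum.swap)
  also have "\<dots> = (\<Sum>l<K. ?C (Suc i) l * ?D j l)"
    using Suc.prems by (simp add: catalan_stieltjes_Suc[of i K] sum_distrib_left sum_distrib_right mult_ac)
  also have "\<dots> = hankel_matrix r s t (Suc i) j" using Suc by simp
  finally show ?case by (simp add: hankel_matrix_def)
qed

text \<open>
  \<open>padded p M\<close> is the block sum of the identity of size \<open>p\<close> and \<open>M\<close>; \<open>transfer p\<close> is the block sum of
  the identity of size \<open>p\<close> and the tridiagonal matrix preceded by the row \<open>(1, 0, 0, \<dots>)\<close>.
\<close>

definition padded :: "nat \<Rightarrow> (nat \<Rightarrow> nat \<Rightarrow> real poly) \<Rightarrow> nat \<Rightarrow> nat \<Rightarrow> real poly" where
  "padded p M i j = (if i < p \<or> j < p then (if i = j then 1 else 0) else M (i - p) (j - p))"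

definition transfer :: "(nat \<Rightarrow> real poly) \<Rightarrow> (nat \<Rightarrow> real poly) \<Rightarrow> (nat \<Rightarrow> real poly) \<Rightarrow> nat \<Rightarrow> nat \<Rightarrow> nat \<Rightarrow> real poly" where
  "transfer r s t p i j = (if i \<le> p then (if i = j then 1 else 0)
     else if j < p then 0 else tridiagonal r s t (i - Suc p) (j - p))"

text \<open>Row \<open>Suc n\<close> of the Catalan-Stieltjes matrix is row \<open>n\<close> times
  the tridiagonal matrix. So the matrix is a copy of itself behind one more identity entry, times
  \<open>transfer\<close>; iteration pushes the copy beyond any given number of rows.\<close>

lemma padded_catalan_stieltjes:
  assumes "i < p + m + 2"
  shows "padded p (catalan_stieltjes r s t) i j =
    (\<Sum>k<p + m + 2. padded (Suc p) (catalan_stieltjes r s t) i k * transfer r s t p k j)"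
proof -
  let ?C = "catalan_stieltjes r s t"
  show ?thesis
  proof (cases "i \<le> p")
    case True
    have "(\<Sum>k<p + m + 2. padded (Suc p) ?C i k * transfer r s t p k j) =
      (\<Sum>k<p + m + 2. if k = i then transfer r s t p i j else 0)"
      using True by (intro sum.cong refl) (auto simp: padded_def)
    also have "\<dots> = (if i = j then 1 else 0)" using True by (simp add: transfer_def)
    also have "\<dots> = padded p ?C i j"
      using True by (cases "j - p") (auto simp: padded_def)
    finally show ?thesis by simp
  next
    case False
    then obtain n where n: "i = Suc p + n" by (metis Suc_leI le_iff_add not_le)
    have "(\<Sum>k<p + m + 2. padded (Suc p) ?C i k * transfer r s t p k j) =
      (\<Sum>k\<in>{Suc p..<p + m + 2}. padded (Suc p) ?C i k * transfer r s t p k j)"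
      using n by (intro sum.mono_neutral_right) (auto simp: padded_def)
    \<comment> \<open>The bound on \<open>i\<close> means \<open>n \<le> m\<close>, so
      \<open>Suc m\<close> columns hold all of row \<open>n\<close>.\<close>
    also have "\<dots> = (\<Sum>l<Suc m. ?C n l * transfer r s t p (Suc p + l) j)"
      by (rule sum.reindex_bij_witness[of _ "\<lambda>l. Suc p + l" "\<lambda>k. k - Suc p"]) (auto simp: n padded_def)
    also have "\<dots> = padded p ?C i j"
    proof (cases "j < p")
      case True
      then show ?thesis by (simp add: transfer_def padded_def n)
    next
      case False
      then show ?thesis using assms n
        by (simp add: transfer_def padded_def catalan_stieltjes_Suc[of n "Suc m"] Suc_diff_le del: catalan_stieltjes.simps sum.lessThan_Suc)
    qed
    finally show ?thesis by simp
  qed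
qed

text \<open>
  Both factors are encoded with intermediate index \<open>Suc p + 2 * k\<close> between levels \<open>k - 1\<close> and \<open>k\<close>
  and \<open>Suc p + 2 * k + 1\<close> for the direct step at level \<open>k\<close>.
\<close>

definition left_factor :: "(nat \<Rightarrow> real poly) \<Rightarrow> (nat \<Rightarrow> real poly) \<Rightarrow> (nat \<Rightarrow> real poly) \<Rightarrow> nat \<Rightarrow> nat \<Rightarrow> nat \<Rightarrow> real poly" where
  "left_factor A X B p i m = (if i \<le> p then (if i = m then 1 else 0)
     else if m = Suc p + 2 * (i - Suc p) then A (i - Suc p)
     else if m = Suc (Suc p + 2 * (i - Suc p)) then X (i - Suc p)
     else if m = Suc (Suc (Suc p + 2 * (i - Suc p))) then B (i - Suc p) else 0)"

definition right_factor :: "(nat \<Rightarrow> real poly) \<Rightarrow> (nat \<Rightarrow> real poly) \<Rightarrow> nat \<Rightarrow> nat \<Rightarrow> nat \<Rightarrow> real poly" where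
  "right_factor C D p m j = (if j < p \<or> m \<le> p then (if m = j then 1 else 0)
     else if m = Suc p + 2 * (j - p) then C (j - p)
     else if m = Suc (Suc p + 2 * (j - p)) then 1
     else if m = Suc (Suc (Suc p + 2 * (j - p))) then D (j - p) else 0)"

text \<open>Beyond the identity block the rows occupy intervals of three intermediate indices,
  consecutive ones sharing only an endpoint.\<close>

lemma monotone_support_left_factor: "monotone_support (left_factor A X B p)"
proof -
  have *: "i \<le> p \<and> m = i \<or> p < i \<and> Suc p + 2 * (i - Suc p) \<le> m \<and> m \<le> Suc p + 2 * (i - Suc p) + 2"
    if "left_factor A X B p i m \<noteq> 0" for i m
    using that by (simp add: left_factor_def split: if_splits)
  show ?thesis
    unfolding monotone_support_def
  proof (intro allI impI)
    fix i m i' m' assume "left_factor A X B p i m \<noteq> 0" "left_factor A X B p i' m' \<noteq> 0" "i < i'"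
    then show "m \<le> m'" using *[of i m] *[of i' m'] by linarith
  qed
qed

lemma monotone_support_right_factor: "monotone_support (right_factor C D p)"
proof -
  have *: "(j < p \<or> m \<le> p) \<and> m = j \<or> p \<le> j \<and> p < m \<and> Suc p + 2 * (j - p) \<le> m \<and> m \<le> Suc p + 2 * (j - p) + 2"
    if "right_factor C D p m j \<noteq> 0" for m j
    using that by (simp add: right_factor_def split: if_splits)
  show ?thesis
    unfolding monotone_support_def
  proof (intro allI impI)
    fix m j m' j' assume "right_factor C D p m j \<noteq> 0" "right_factor C D p m' j' \<noteq> 0" "m < m'"
    then show "j \<le> j'" using *[of m j] *[of m' j'] by linarith
  qed
qed

lemma monotone_support_transpose: "monotone_support M \<Longrightarrow> monotone_support (\<lambda>i j. M j i)"
  unfolding monotone_support_def by (meson not_le)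

text \<open>A count of two-step paths. Level \<open>k\<close> is left to the node below it
  (\<open>A\<close>), directly (\<open>X\<close>) or to the node above it (\<open>B\<close>); a node
  is left to the level above it (\<open>C\<close>) or below it (\<open>D\<close>). Staying, rising
  and falling by one level give \<open>s\<close>, \<open>r\<close> and \<open>t\<close>.\<close>

lemma transfer_factorization:
  assumes i: "i < R"
    and s: "\<And>k. s k = A k * C k + X k + B k * D k" and r: "\<And>k. r k = B k * C (Suc k)"
    and t: "\<And>k. t (Suc k) = A (Suc k) * D k"
  shows "transfer r s t p i j = (\<Sum>m<p + 2 * R + 3. left_factor A X B p i m * right_factor C D p m j)"
proof (cases "i \<le> p")
  case True
  have "(\<Sum>m<p + 2 * R + 3. left_factor A X B p i m * right_factor C D p m j) =
    (\<Sum>m<p + 2 * R + 3. if m = i then right_factor C D p i j else 0)"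
    using True by (intro sum.cong refl) (auto simp: left_factor_def)
  also have "\<dots> = right_factor C D p i j" using i by simp
  finally show ?thesis using True by (simp add: transfer_def right_factor_def)
next
  case False
  then obtain k where k: "i = Suc p + k" by (metis Suc_leI le_iff_add not_le)
  let ?m = "Suc p + 2 * k"
  have "(\<Sum>m<p + 2 * R + 3. left_factor A X B p i m * right_factor C D p m j) =
    (\<Sum>m\<in>{?m, Suc ?m, Suc (Suc ?m)}. left_factor A X B p i m * right_factor C D p m j)"
    using i k by (intro sum.mono_neutral_right) (auto simp: left_factor_def)
  also have "\<dots> = A k * right_factor C D p ?m j + X k * right_factor C D p (Suc ?m) j
      + B k * right_factor C D p (Suc (Suc ?m)) j"
    by (simp add: left_factor_def k)
  also have "\<dots> = transfer r s t p i j"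
  proof (cases "j < p")
    case True
    then show ?thesis by (simp add: right_factor_def transfer_def k)
  next
    case False
    then obtain l where l: "j = p + l" by (metis le_iff_add not_le)
    consider "l = k" | "l = Suc k" | "Suc l = k" | "l \<noteq> k" "l \<noteq> Suc k" "Suc l \<noteq> k" by blast
    then show ?thesis
    proof cases
      case 4
      have "2 * k \<noteq> Suc (2 * l)" "Suc (2 * k) \<noteq> 2 * l" by presburger+
      then show ?thesis using 4 by (simp add: right_factor_def transfer_def tridiagonal_def k l)
    qed (auto simp: right_factor_def transfer_def tridiagonal_def k l s r t, (presburger+)?)
  qed
  finally show ?thesis by simp
qed

section \<open>Positivity of the factored matrices\<close>

context positive_sym_rep
begin

text \<open>The transpose is carried along because the second Hankel factor enters
  transposed.\<close>

definition nonneg_matrix_sym :: "nat \<Rightarrow> nat \<Rightarrow> (nat \<Rightarrow> nat \<Rightarrow> real poly) \<Rightarrow> bool" where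
  "nonneg_matrix_sym R S M \<longleftrightarrow> nonneg_matrix R S M \<and> nonneg_matrix S R (\<lambda>i j. M j i)"

lemma nonneg_matrix_sym_monotone_support:
  "monotone_support M \<Longrightarrow> (\<And>i j. q_nonneg (M i j)) \<Longrightarrow> nonneg_matrix_sym R S M"
  unfolding nonneg_matrix_sym_def
  by (blast intro: nonneg_matrix_monotone_support monotone_support_transpose)

lemma nonneg_matrix_sym_mult:
  assumes "nonneg_matrix_sym R K M" "nonneg_matrix_sym K S N"
    and "\<And>i j. i < R \<Longrightarrow> j < S \<Longrightarrow> P i j = (\<Sum>k<K. M i k * N k j)"
  shows "nonneg_matrix_sym R S P"
  unfolding nonneg_matrix_sym_def
proof
  show "nonneg_matrix R S P"
    using nonneg_matrix_cong[OF nonneg_matrix_mult[of R K M S N]] assms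
    by (simp add: nonneg_matrix_sym_def)
  have "nonneg_matrix S R (\<lambda>i j. \<Sum>k<K. N k i * M j k)"
    using nonneg_matrix_mult[of S K "\<lambda>i j. N j i" R "\<lambda>i j. M j i"] assms
    by (simp add: nonneg_matrix_sym_def)
  then show "nonneg_matrix S R (\<lambda>i j. P j i)"
    by (rule nonneg_matrix_cong) (simp add: assms(3) mult.commute)
qed

lemma nonneg_matrix_sym_padded_catalan_stieltjes:
  assumes nonneg: "\<And>k. q_nonneg (A k)" "\<And>k. q_nonneg (X k)" "\<And>k. q_nonneg (F k)"
      "\<And>k. q_nonneg (C k)" "\<And>k. q_nonneg (D k)"
    and s: "\<And>k. s k = A k * C k + X k + F k * D k" and r: "\<And>k. r k = F k * C (Suc k)"
    and t: "\<And>k. t (Suc k) = A (Suc k) * D k"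
  shows "nonneg_matrix_sym (p + m + 1) S (padded p (catalan_stieltjes r s t))"
proof (induction m arbitrary: p S)
  case 0
  let ?I = "\<lambda>i j. if i = j then 1 else (0 :: real poly)"
  have I: "monotone_support ?I" by (simp add: monotone_support_def)
  \<comment> \<open>Row \<open>p\<close> is included: it is the first row (1, 0, 0, ...) of the
    Catalan-Stieltjes matrix.\<close>
  have "padded p (catalan_stieltjes r s t) i j = ?I i j" if "i < p + 0 + 1" for i j
    using that by (cases "j - p") (auto simp: padded_def)
  moreover have "nonneg_matrix_sym (p + 0 + 1) S ?I"
    by (rule nonneg_matrix_sym_monotone_support[OF I]) simp
  ultimately show ?case
    unfolding nonneg_matrix_sym_def by (auto elim!: nonneg_matrix_cong)
next
  case (Suc m)
  have T: "nonneg_matrix_sym (p + m + 2) S (transfer r s t p)"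
  proof (rule nonneg_matrix_sym_mult)
    show "nonneg_matrix_sym (p + m + 2) (p + 2 * (p + m + 2) + 3) (left_factor A X F p)"
      by (rule nonneg_matrix_sym_monotone_support[OF monotone_support_left_factor])
        (unfold left_factor_def, intro q_nonneg_if q_nonneg_0 q_nonneg_1 nonneg)
    show "nonneg_matrix_sym (p + 2 * (p + m + 2) + 3) S (right_factor C D p)"
      by (rule nonneg_matrix_sym_monotone_support[OF monotone_support_right_factor])
        (unfold right_factor_def, intro q_nonneg_if q_nonneg_0 q_nonneg_1 nonneg)
    show "transfer r s t p i j = (\<Sum>k<p + 2 * (p + m + 2) + 3. left_factor A X F p i k * right_factor C D p k j)"
      if "i < p + m + 2" for i j
      by (rule transfer_factorization[OF that]) (rule s r t)+
  qed
  have "nonneg_matrix_sym (p + m + 2) (p + m + 2) (padded (Suc p) (catalan_stieltjes r s t))"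
    using Suc[of "Suc p" "p + m + 2"] by simp
  from nonneg_matrix_sym_mult[OF this T padded_catalan_stieltjes]
  show ?case by simp
qed

lemma nonneg_matrix_sym_catalan_stieltjes:
  assumes "\<And>k. q_nonneg (A k)" "\<And>k. q_nonneg (X k)" "\<And>k. q_nonneg (F k)"
      "\<And>k. q_nonneg (C k)" "\<And>k. q_nonneg (D k)"
    and "\<And>k. s k = A k * C k + X k + F k * D k" and "\<And>k. r k = F k * C (Suc k)"
    and "\<And>k. t (Suc k) = A (Suc k) * D k"
  shows "nonneg_matrix_sym (Suc m) S (catalan_stieltjes r s t)"
  using nonneg_matrix_sym_padded_catalan_stieltjes[of A X F C D s r t 0 m S] assms
  by (simp add: padded_def[abs_def])

lemma nonneg_matrix_hankel:
  assumes nonneg: "\<And>k. q_nonneg (A k)" "\<And>k. q_nonneg (X k)" "\<And>k. q_nonneg (F k)"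
      "\<And>k. q_nonneg (C k)" "\<And>k. q_nonneg (D k)"
    and s: "\<And>k. s k = A k * C k + X k + F k * D k" and r: "\<And>k. r k = F k * C (Suc k)"
    and t: "\<And>k. t (Suc k) = A (Suc k) * D k"
  shows "nonneg_matrix (Suc m) (Suc m) (hankel_matrix r s t)"
proof -
  let ?D = "catalan_stieltjes (\<lambda>k. t (Suc k)) s (\<lambda>k. r (k - 1))"
  have "nonneg_matrix_sym (Suc m) (2 * m + 1) (catalan_stieltjes r s t)"
    by (rule nonneg_matrix_sym_catalan_stieltjes[of A X F C D]) (fact assms)+
  \<comment> \<open>Transposing the tridiagonal matrix exchanges \<open>A\<close> with
    \<open>C\<close> and \<open>F\<close> with \<open>D\<close>.\<close>
  moreover have "nonneg_matrix_sym (Suc m) (2 * m + 1) ?D"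
    by (rule nonneg_matrix_sym_catalan_stieltjes[of C X D A F])
      (simp_all add: nonneg s r t algebra_simps)
  ultimately have "nonneg_matrix (Suc m) (Suc m) (\<lambda>i j. \<Sum>k<2 * m + 1. catalan_stieltjes r s t i k * ?D j k)"
    using nonneg_matrix_mult[of "Suc m" "2 * m + 1" "catalan_stieltjes r s t" "Suc m" "\<lambda>i j. ?D j i"]
    by (simp add: nonneg_matrix_sym_def)
  then show ?thesis
    by (rule nonneg_matrix_cong) (rule hankel_matrix_factorization[symmetric], simp)
qed

end

subsection \<open>Specht modules\<close>

text \<open>\<open>trace_on\<close> fixes an arbitrary basis; this allows evaluation in the
  seminormal one.\<close>

lemma (in vector_space) trace_basis_independent:
  assumes B: "independent B" "finite B" and C: "independent C" "finite C" and span: "span B = span C"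
    and f_add: "\<And>u v. f (u + v) = f u + f v" and f_scale: "\<And>c u. f (scale c u) = scale c (f u)"
    and f_closed: "\<And>v. v \<in> span B \<Longrightarrow> f v \<in> span B"
  shows "(\<Sum>b\<in>B. representation B (f b) b) = (\<Sum>c\<in>C. representation C (f c) c)"
proof -
  have f_sum: "f (\<Sum>i\<in>I. g i) = (\<Sum>i\<in>I. f (g i))" for I and g :: "'b \<Rightarrow> 'b"
    using f_scale[of 0 0] by (induction I rule: infinite_finite_induct) (auto simp: f_add)
  have inB: "f c \<in> span B" if "c \<in> C" for c using that span f_closed span_base by blast
  have rep: "representation E v e = (\<Sum>d\<in>D. representation D v d * representation E d e)"
    if "independent D" "finite D" "independent E" "finite E" "span D = span E" "v \<in> span D" for D E v e
  proof -
    have "representation E (\<Sum>d\<in>D. scale (representation D v d) d) e =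
        (\<Sum>d\<in>D. representation D v d * representation E d e)"
      using that by (simp add: representation_sum representation_scale span_scale span_base flip: that(5))
    then show ?thesis using that by (simp add: sum_representation_eq)
  qed
  have "(\<Sum>b\<in>B. representation B (f b) b) = (\<Sum>b\<in>B. \<Sum>c\<in>C. representation C b c * representation B (f c) b)"
  proof (rule sum.cong[OF refl])
    fix b assume b: "b \<in> B"
    have bC: "b \<in> span C" using b span span_base by blast
    have "f b = f (\<Sum>c\<in>C. scale (representation C b c) c)"
      using C bC by (simp add: sum_representation_eq)
    also have "\<dots> = (\<Sum>c\<in>C. scale (representation C b c) (f c))"
      by (simp add: f_sum f_scale)
    finally show "representation B (f b) b = (\<Sum>c\<in>C. representation C b c * representation B (f c) b)"
      using B inB by (simp add: representation_sum representation_scale span_scale)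
  qed
  also have "\<dots> = (\<Sum>c\<in>C. \<Sum>b\<in>B. representation B (f c) b * representation C b c)"
    by (subst sum.swap) (simp add: mult.commute)
  also have "\<dots> = (\<Sum>c\<in>C. representation C (f c) c)"
    using rep[OF B C span] inB by simp
  finally show ?thesis .
qed

text \<open>A finite superset of the tabloids, stable under permutations of the letters; finite
  dimension and the inner product rest on it.\<close>

definition tabloid_range :: "nat list \<Rightarrow> nat set list set" where
  "tabloid_range lam = {X. length X = length lam \<and> (\<forall>R\<in>set X. R \<subseteq> {..<sum_list lam})}"

lemma finite_tabloid_range: "finite (tabloid_range lam)"
proof -
  have "tabloid_range lam = {X. set X \<subseteq> Pow {..<sum_list lam} \<and> length X = length lam}"
    by (auto simp: tabloid_range_def)
  then show ?thesis by (simp add: finite_lists_length_eq)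
qed

lemma tableau_compose: "tableau lam T \<Longrightarrow> p permutes {..<sum_list lam} \<Longrightarrow> tableau lam (p \<circ> T)"
  by (auto simp: tableau_def intro: bij_betw_trans permutes_imp_bij)

lemma tabloid_in_range:
  assumes "tableau lam T"
  shows "tabloid lam T \<in> tabloid_range lam"
proof -
  have "T c < sum_list lam" if "c \<in> cells lam" for c
    using assms that by (auto simp: tableau_def bij_betw_def)
  then show ?thesis by (auto simp: tabloid_range_def tabloid_def cells_def)
qed

lemma map_image_tabloid: "map ((`) p) (tabloid lam T) = tabloid lam (p \<circ> T)"
  by (simp add: tabloid_def image_comp)

lemma map_image_inv:
  assumes "p permutes A"
  shows "map ((`) p) (map ((`) (Hilbert_Choice.inv p)) X) = X"
    and "map ((`) (Hilbert_Choice.inv p)) (map ((`) p) X) = X"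
  using permutes_inv_o[OF assms] by (simp_all add: image_comp comp_def[of "(`) _"])

lemma conjugate_column_stabilizer:
  assumes p: "p permutes {..<sum_list lam}" and \<pi>: "\<pi> \<in> column_stabilizer lam T"
  shows "p \<circ> \<pi> \<circ> Hilbert_Choice.inv p \<in> column_stabilizer lam (p \<circ> T)"
proof -
  have "(p \<circ> \<pi> \<circ> Hilbert_Choice.inv p) ` ((p \<circ> T) ` C) = p ` (\<pi> ` (T ` C))" for C
    by (simp add: image_image permutes_inverses[OF p])
  moreover have "p ` (T ` C) = (p \<circ> T) ` C" for C
    by (simp add: image_comp)
  ultimately show ?thesis using p \<pi>
    unfolding column_stabilizer_def mem_Collect_eq by (simp only: permutes_compose permutes_inv simp_thms)
qed

lemma perm_action_polytabloid:
  assumes p: "p permutes {..<sum_list lam}"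
  shows "perm_action p (polytabloid lam T) = polytabloid lam (p \<circ> T)"
proof
  fix X
  let ?q = "Hilbert_Choice.inv p"
  have q: "?q permutes {..<sum_list lam}" using p by (rule permutes_inv)
  have qq: "Hilbert_Choice.inv ?q = p" using p by (simp add: permutes_inv_inv)
  have "perm_action p (polytabloid lam T) X = (\<Sum>\<pi>\<in>column_stabilizer lam T.
      of_int (sign \<pi>) * (if map ((`) ?q) X = tabloid lam (\<pi> \<circ> T) then 1 else 0))"
    by (simp add: perm_action_def polytabloid_def)
  also have "\<dots> = (\<Sum>\<pi>\<in>column_stabilizer lam (p \<circ> T).
      of_int (sign \<pi>) * (if X = tabloid lam (\<pi> \<circ> (p \<circ> T)) then 1 else 0))"
  proof (rule sum.reindex_bij_witness[of _ "\<lambda>\<pi>. ?q \<circ> \<pi> \<circ> p" "\<lambda>\<pi>. p \<circ> \<pi> \<circ> ?q"])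
    fix \<pi> assume \<pi>: "\<pi> \<in> column_stabilizer lam T"
    then have perm: "\<pi> permutes {..<sum_list lam}" by (simp add: column_stabilizer_def)
    show "?q \<circ> (p \<circ> \<pi> \<circ> ?q) \<circ> p = \<pi>" by (simp add: fun_eq_iff permutes_inverses[OF p])
    show "p \<circ> \<pi> \<circ> ?q \<in> column_stabilizer lam (p \<circ> T)" by (rule conjugate_column_stabilizer[OF p \<pi>])
    have "sign (p \<circ> \<pi> \<circ> ?q) = sign \<pi>"
    proof -
      have "permutation p" "permutation \<pi>" "permutation ?q"
        using p perm q by (auto intro: permutation_permutes[THEN iffD2])
      then show ?thesis by (simp add: sign_compose permutation_compose sign_inverse sign_idempotent mult.commute)
    qed
    moreover have "tabloid lam ((p \<circ> \<pi> \<circ> ?q) \<circ> (p \<circ> T)) = map ((`) p) (tabloid lam (\<pi> \<circ> T))"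
      by (simp add: map_image_tabloid comp_def permutes_inverses[OF p])
    moreover have "map ((`) ?q) X = Y \<longleftrightarrow> X = map ((`) p) Y" for Y
      using map_image_inv[OF p] by metis
    ultimately show "of_int (sign (p \<circ> \<pi> \<circ> ?q)) * (if X = tabloid lam ((p \<circ> \<pi> \<circ> ?q) \<circ> (p \<circ> T)) then 1 else 0) =
      of_int (sign \<pi>) * (if map ((`) ?q) X = tabloid lam (\<pi> \<circ> T) then 1 else (0 :: real))"
      by simp
  next
    fix \<pi> assume \<pi>: "\<pi> \<in> column_stabilizer lam (p \<circ> T)"
    show "p \<circ> (?q \<circ> \<pi> \<circ> p) \<circ> ?q = \<pi>" by (simp add: fun_eq_iff permutes_inverses[OF p])
    have "?q \<circ> (p \<circ> T) = T" by (simp add: fun_eq_iff permutes_inverses[OF p])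
    then show "?q \<circ> \<pi> \<circ> p \<in> column_stabilizer lam T"
      using conjugate_column_stabilizer[OF q \<pi>] qq by simp
  qed
  also have "\<dots> = polytabloid lam (p \<circ> T) X" by (simp add: polytabloid_def)
  finally show "perm_action p (polytabloid lam T) X = polytabloid lam (p \<circ> T) X" .
qed

definition indicator_of :: "'a \<Rightarrow> 'a \<Rightarrow> real" where
  "indicator_of Y = (\<lambda>X. if X = Y then 1 else 0)"

lemma sum_fun_apply: "(\<Sum>i\<in>I. f i) x = (\<Sum>i\<in>I. f i x)"
  by (induction I rule: infinite_finite_induct) auto

lemma specht_module_subset:
  "specht_module lam \<subseteq> fun_vs.span (indicator_of ` tabloid_range lam)"
  unfolding specht_module_def
proof (rule fun_vs.span_minimal)
  show "{polytabloid lam T |T. tableau lam T} \<subseteq> fun_vs.span (indicator_of ` tabloid_range lam)"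
  proof clarify
    fix T assume T: "tableau lam T"
    have eq: "polytabloid lam T = (\<Sum>\<pi>\<in>column_stabilizer lam T.
        (\<lambda>X. of_int (sign \<pi>) * indicator_of (tabloid lam (\<pi> \<circ> T)) X))"
      by (simp add: fun_eq_iff sum_fun_apply polytabloid_def indicator_of_def)
    show "polytabloid lam T \<in> fun_vs.span (indicator_of ` tabloid_range lam)"
      unfolding eq
    proof (intro fun_vs.span_sum fun_vs.span_scale fun_vs.span_base imageI tabloid_in_range tableau_compose T)
      fix \<pi> assume "\<pi> \<in> column_stabilizer lam T"
      then show "\<pi> permutes {..<sum_list lam}" by (simp add: column_stabilizer_def)
    qed
  qed
qed simp

text \<open>Makes \<open>tabloid_inner\<close> definite on the module: a vector vanishing on
  \<open>tabloid_range lam\<close> is zero.\<close>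

lemma specht_module_support:
  assumes "v \<in> specht_module lam" "X \<notin> tabloid_range lam"
  shows "v X = 0"
proof -
  have "fun_vs.subspace {v. v X = 0}" by (rule fun_vs.subspaceI) auto
  then have "fun_vs.span (indicator_of ` tabloid_range lam) \<subseteq> {v. v X = 0}"
    using assms(2) by (intro fun_vs.span_minimal) (auto simp: indicator_of_def)
  then show ?thesis using specht_module_subset assms(1) by blast
qed

lemma perm_action_closed:
  assumes p: "p permutes {..<sum_list lam}" and v: "v \<in> specht_module lam"
  shows "perm_action p v \<in> specht_module lam"
proof -
  have "fun_vs.subspace {v. perm_action p v \<in> specht_module lam}"
  proof (rule fun_vs.subspaceI)
    show "0 \<in> {v. perm_action p v \<in> specht_module lam}"
      using fun_vs.span_zero by (simp add: perm_action_def specht_module_def zero_fun_def)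
  next
    fix u v assume "u \<in> {v. perm_action p v \<in> specht_module lam}" "v \<in> {v. perm_action p v \<in> specht_module lam}"
    then show "u + v \<in> {v. perm_action p v \<in> specht_module lam}"
      using fun_vs.span_add[of "perm_action p u" _ "perm_action p v"]
      by (simp add: perm_action_def specht_module_def plus_fun_def)
  next
    fix c u assume "u \<in> {v. perm_action p v \<in> specht_module lam}"
    then show "(\<lambda>x. c * u x) \<in> {v. perm_action p v \<in> specht_module lam}"
      using fun_vs.span_scale[of "perm_action p u" _ c]
      by (simp add: perm_action_def specht_module_def)
  qed
  moreover have "{polytabloid lam T |T. tableau lam T} \<subseteq> {v. perm_action p v \<in> specht_module lam}"
    using p by (auto simp: perm_action_polytabloid specht_module_def intro!: fun_vs.span_base tableau_compose)
  ultimately show ?thesis using v fun_vs.span_minimal unfolding specht_module_def by blast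
qed

definition tabloid_inner :: "nat list \<Rightarrow> (nat set list \<Rightarrow> real) \<Rightarrow> (nat set list \<Rightarrow> real) \<Rightarrow> real" where
  "tabloid_inner lam u v = (\<Sum>X\<in>tabloid_range lam. u X * v X)"

lemma orthogonal_sym_rep_specht_module:
  "orthogonal_sym_rep (\<lambda>(c::real) f x. c * f x) (sum_list lam) (specht_module lam) (tabloid_inner lam) perm_action"
proof (unfold_locales, goal_cases)
  case 1
  show ?case by (simp add: specht_module_def)
next
  case 2
  show ?case
    using specht_module_subset[of lam] finite_imageI[OF finite_tabloid_range[of lam], of indicator_of] by (intro exI conjI)
next
  case (3 u v w)
  show ?case by (simp add: tabloid_inner_def algebra_simps sum.distrib)
next
  case (4 c u w)
  show ?case by (simp add: tabloid_inner_def algebra_simps sum_distrib_left)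
next
  case (5 u v)
  show ?case by (simp add: tabloid_inner_def mult.commute)
next
  case (6 v)
  then obtain X where X: "v X \<noteq> 0" by (auto simp: fun_eq_iff)
  then have "X \<in> tabloid_range lam" using specht_module_support 6 by blast
  then show ?case unfolding tabloid_inner_def using X
    by (intro sum_pos2[OF finite_tabloid_range]) (auto simp: zero_less_mult_iff linorder_neq_iff)
next
  case (7 p u v)
  show ?case by (simp add: perm_action_def fun_eq_iff)
next
  case (8 p c u)
  show ?case by (simp add: perm_action_def)
next
  case (9 p v)
  then show ?case by (rule perm_action_closed)
next
  case (10 p q v)
  then have "Hilbert_Choice.inv (p \<circ> q) = Hilbert_Choice.inv q \<circ> Hilbert_Choice.inv p"
    by (simp add: o_inv_distrib permutes_bij)
  then show ?case by (simp add: perm_action_def image_comp comp_def)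
next
  case (11 v)
  show ?case by (simp add: perm_action_def image_ident[abs_def] id_def[symmetric])
next
  case (12 p u v)
  let ?f = "map ((`) (Hilbert_Choice.inv p))"
  have "bij_betw ?f (tabloid_range lam) (tabloid_range lam)"
  proof (rule bij_betw_byWitness[where f' = "map ((`) p)"])
    have *: "map ((`) q) ` tabloid_range lam \<subseteq> tabloid_range lam" if "q permutes {..<sum_list lam}" for q
      using permutes_less[OF that] by (force simp: tabloid_range_def)
    show "map ((`) p) ` tabloid_range lam \<subseteq> tabloid_range lam" "?f ` tabloid_range lam \<subseteq> tabloid_range lam"
      using * 12 permutes_inv by blast+
  qed (simp_all only: map_image_inv[OF 12] ball_simps, simp_all)
  then show ?case unfolding tabloid_inner_def perm_action_def
    by (rule sum.reindex_bij_betw)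
qed

section \<open>Characters and immanants in the seminormal basis\<close>

definition specht_basis :: "nat list \<Rightarrow> (nat set list \<Rightarrow> real) set" where
  "specht_basis lam = orthogonal_sym_rep.seminormal_basis (\<lambda>(c::real) f x. c * f x) (sum_list lam) (specht_module lam) perm_action"

definition specht_coeff :: "nat list \<Rightarrow> (nat \<Rightarrow> nat) \<Rightarrow> (nat set list \<Rightarrow> real) \<Rightarrow> (nat set list \<Rightarrow> real) \<Rightarrow> real" where
  "specht_coeff lam = orthogonal_sym_rep.rep_coeff (\<lambda>(c::real) f x. c * f x) (sum_list lam) (specht_module lam) perm_action"

lemma positive_sym_rep_specht:
  "positive_sym_rep (sum_list lam) (specht_basis lam) (specht_coeff lam)"
proof -
  interpret orthogonal_sym_rep "\<lambda>(c::real) f x. c * f x" "sum_list lam" "specht_module lam" "tabloid_inner lam" perm_action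
    by (rule orthogonal_sym_rep_specht_module)
  show ?thesis unfolding specht_basis_def specht_coeff_def
    by unfold_locales (auto simp: finite_seminormal_basis rep_coeff_comp young_symmetrizer_nonneg)
qed

lemma sym_char_eq_sum_specht_coeff:
  assumes w: "w permutes {..<sum_list lam}"
  shows "sym_char lam w = (\<Sum>b\<in>specht_basis lam. specht_coeff lam w b b)"
proof -
  interpret orthogonal_sym_rep "\<lambda>(c::real) f x. c * f x" "sum_list lam" "specht_module lam" "tabloid_inner lam" perm_action
    by (rule orthogonal_sym_rep_specht_module)
  define C where "C = (SOME C. fun_vs.independent C \<and> fun_vs.span C = specht_module lam)"
  have C: "fun_vs.independent C" "fun_vs.span C = specht_module lam"
    using someI_ex[of "\<lambda>C. fun_vs.independent C \<and> fun_vs.span C = specht_module lam"]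
      independent_seminormal_basis span_seminormal_basis unfolding C_def by blast+
  have "finite C"
    using finite_dim fun_vs.independent_span_bound[of _ C] C fun_vs.span_superset[of C] by auto
  have "sym_char lam w = (\<Sum>b\<in>C. fun_vs.representation C (perm_action w b) b)"
    by (simp add: sym_char_def trace_on_def C_def Let_def)
  also have "\<dots> = (\<Sum>b\<in>seminormal_basis. fun_vs.representation seminormal_basis (perm_action w b) b)"
    using C \<open>finite C\<close> independent_seminormal_basis finite_seminormal_basis span_seminormal_basis
      act_add act_scale act_closed[OF w]
    by (intro fun_vs.trace_basis_independent) auto
  finally show ?thesis by (simp add: specht_basis_def specht_coeff_def rep_coeff_def)
qed

text \<open>As the character is a trace, the immanant is a sum of diagonal entries of a matrix whose
  entries are all q-nonnegative.\<close>

lemma immanant_nonneg: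
  assumes lam: "is_partition lam n" and M: "square_submatrix n A M"
    and A: "\<And>m. positive_sym_rep.nonneg_matrix n (specht_basis lam) (specht_coeff lam) (Suc m) (Suc m) A"
  shows "q_nonneg (immanant lam M)"
proof -
  have n: "sum_list lam = n" using lam by (simp add: is_partition_def)
  interpret positive_sym_rep n "specht_basis lam" "specht_coeff lam"
    using positive_sym_rep_specht[of lam] n by simp
  obtain a b where ab: "strict_mono_on {..<n} a" "strict_mono_on {..<n} b" "M = mat n n (\<lambda>(i, j). A (a i) (b j))"
    using M by (auto simp: square_submatrix_def)
  have "immanant lam M = (\<Sum>w\<in>perms n. Polynomial.smult (sym_char lam w) (matching_weight n a b A w))"
    unfolding immanant_def ab(3)
    by (intro sum.cong) (auto simp: matching_weight_def permutes_less intro!: arg_cong2[of _ _ _ _ Polynomial.smult] prod.cong)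
  also have "\<dots> = (\<Sum>w\<in>perms n. \<Sum>c\<in>specht_basis lam.
      Polynomial.smult (specht_coeff lam w c c) (matching_weight n a b A w))"
    using n by (intro sum.cong refl) (simp add: sym_char_eq_sum_specht_coeff smult_sum)
  also have "\<dots> = (\<Sum>c\<in>specht_basis lam. entry (matching_weight n a b A) c c)"
    unfolding entry_def by (rule sum.swap)
  finally have eq: "immanant lam M = (\<Sum>c\<in>specht_basis lam. entry (matching_weight n a b A) c c)" .
  \<comment> \<open>For \<open>n = 0\<close> this is the maximum of the empty set, but then no index
    has to be bounded.\<close>
  define m where "m = Max (a ` {..<n} \<union> b ` {..<n})"
  have "a i < Suc m \<and> b i < Suc m" if "i < n" for i
    unfolding m_def using that by (auto simp: less_Suc_eq_le intro!: Max_ge)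
  then have "nonneg_element (matching_weight n a b A)"
    using A[of m] strict_mono_on_imp_mono_on[OF ab(1)] strict_mono_on_imp_mono_on[OF ab(2)]
    by (auto simp: nonneg_matrix_def)
  then show ?thesis unfolding eq nonneg_element_def by (auto intro: q_nonneg_sum)
qed

lemma immanants_nonneg_if_factorization:
  assumes nonneg: "\<And>k. q_nonneg (A k)" "\<And>k. q_nonneg (X k)" "\<And>k. q_nonneg (F k)"
      "\<And>k. q_nonneg (C k)" "\<And>k. q_nonneg (D k)"
    and s: "\<And>k. s k = A k * C k + X k + F k * D k" and r: "\<And>k. r k = F k * C (Suc k)"
    and t: "\<And>k. t (Suc k) = A (Suc k) * D k"
  shows "(\<forall>n lam M. is_partition lam n \<longrightarrow> square_submatrix n (catalan_stieltjes r s t) M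
            \<longrightarrow> q_nonneg (immanant lam M))
       \<and> (\<forall>n lam M. is_partition lam n \<longrightarrow> square_submatrix n (hankel_matrix r s t) M
            \<longrightarrow> q_nonneg (immanant lam M))"
proof (intro conjI allI impI)
  fix n lam M assume lam: "is_partition lam n"
  then interpret positive_sym_rep n "specht_basis lam" "specht_coeff lam"
    using positive_sym_rep_specht[of lam] by (simp add: is_partition_def)
  have "nonneg_matrix_sym (Suc m) (Suc m) (catalan_stieltjes r s t)" for m
    by (rule nonneg_matrix_sym_catalan_stieltjes[of A X F C D]) (fact assms)+
  then show "square_submatrix n (catalan_stieltjes r s t) M \<Longrightarrow> q_nonneg (immanant lam M)"
    using immanant_nonneg[OF lam] by (simp add: nonneg_matrix_sym_def)
  have "nonneg_matrix (Suc m) (Suc m) (hankel_matrix r s t)" for m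
    by (rule nonneg_matrix_hankel[of A X F C D]) (fact assms)+
  then show "square_submatrix n (hankel_matrix r s t) M \<Longrightarrow> q_nonneg (immanant lam M)"
    using immanant_nonneg[OF lam] by simp
qed

theorem theorem1p2:
  fixes r s t :: "nat \<Rightarrow> real poly"
  assumes r_nonneg: "\<And>k. q_nonneg (r k)"
    and s_nonneg: "\<And>k. q_nonneg (s k)"
    and t_nonneg: "\<And>k. k \<ge> 1 \<Longrightarrow> q_nonneg (t k)"
    and conditions:
      "(s 0 \<ge>\<^sub>q r 0 \<and> (\<forall>k\<ge>1. s k \<ge>\<^sub>q r k + t k))
       \<or> (s 0 \<ge>\<^sub>q t 1 \<and> (\<forall>k\<ge>1. s k \<ge>\<^sub>q r (k - 1) + t (k + 1)))
       \<or> (s 0 \<ge>\<^sub>q 1 \<and> (\<forall>k\<ge>1. s k \<ge>\<^sub>q r (k - 1) * t k + 1))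
       \<or> (s 0 \<ge>\<^sub>q r 0 * t 1 \<and> (\<forall>k\<ge>1. s k \<ge>\<^sub>q r k * t (k + 1) + 1))
       \<or> (\<exists>b c :: nat \<Rightarrow> real poly. \<forall>k. q_nonneg (b k) \<and> q_nonneg (c k) \<and>
            r k = 1 \<and> s k = b k + c k \<and> t (k + 1) = b (k + 1) * c k)"
  shows "(\<forall>n lam M. is_partition lam n \<longrightarrow> square_submatrix n (catalan_stieltjes r s t) M
            \<longrightarrow> q_nonneg (immanant lam M))
       \<and> (\<forall>n lam M. is_partition lam n \<longrightarrow> square_submatrix n (hankel_matrix r s t) M
            \<longrightarrow> q_nonneg (immanant lam M))"
proof -
  \<comment> \<open>Index 0 is special in every condition: extending \<open>r (k - 1)\<close> and
    \<open>t k\<close> by 0, and the summand 1 of the fourth condition by \<open>e 0 = 0\<close>,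
    lets one formula cover \<open>s 0\<close> and the later \<open>s k\<close>.\<close>
  define r' where "r' k = (if k = 0 then 0 else r (k - 1))" for k
  define t' where "t' k = (if k = 0 then 0 else t k)" for k
  define e where "e k = (if k = 0 then 0 else 1 :: real poly)" for k :: nat
  note aux = r'_def t'_def e_def
  have nonneg: "q_nonneg (r' k)" "q_nonneg (t' k)" "q_nonneg (e k)" "q_nonneg (t (Suc k))" for k
    using r_nonneg t_nonneg by (simp_all add: aux)
  have ge: "q_nonneg (s k - u k)" if "s 0 \<ge>\<^sub>q u 0" "\<And>k. k \<ge> 1 \<Longrightarrow> s k \<ge>\<^sub>q u k" for u k
    using that by (cases "k = 0") (auto simp: q_ge_def)
  from conditions consider
      "s 0 \<ge>\<^sub>q r 0" "\<forall>k\<ge>1. s k \<ge>\<^sub>q r k + t k"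
    | "s 0 \<ge>\<^sub>q t 1" "\<forall>k\<ge>1. s k \<ge>\<^sub>q r (k - 1) + t (k + 1)"
    | "s 0 \<ge>\<^sub>q 1" "\<forall>k\<ge>1. s k \<ge>\<^sub>q r (k - 1) * t k + 1"
    | "s 0 \<ge>\<^sub>q r 0 * t 1" "\<forall>k\<ge>1. s k \<ge>\<^sub>q r k * t (k + 1) + 1"
    | b c where "\<forall>k. q_nonneg (b k) \<and> q_nonneg (c k) \<and>
            r k = 1 \<and> s k = b k + c k \<and> t (k + 1) = b (k + 1) * c k"
    by blast
  \<comment> \<open>In the first four cases \<open>r k\<close> is placed in \<open>F k\<close> or
    \<open>C (Suc k)\<close> and \<open>t (Suc k)\<close> in \<open>A (Suc k)\<close> or
    \<open>D k\<close>, the partners being 1; the four combinations are exactly the four conditions,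
    and \<open>X\<close> takes up the slack. The fifth condition is the factorization itself with
    \<open>A = b\<close>, \<open>D = c\<close> and \<open>X = 0\<close>.\<close>
  then show ?thesis
  proof cases
    case 1
    show ?thesis
    proof (rule immanants_nonneg_if_factorization[of t' "\<lambda>k. s k - (t' k + r k)" r "\<lambda>_. 1" "\<lambda>_. 1"])
      show "q_nonneg (s k - (t' k + r k))" for k
        using 1 by (intro ge) (auto simp: aux add.commute)
    qed (simp_all add: nonneg r_nonneg, simp_all add: aux)
  next
    case 2
    show ?thesis
    proof (rule immanants_nonneg_if_factorization[of "\<lambda>_. 1" "\<lambda>k. s k - (r' k + t (Suc k))" "\<lambda>_. 1" r' "\<lambda>k. t (Suc k)"])
      show "q_nonneg (s k - (r' k + t (Suc k)))" for k
        using 2 by (intro ge) (auto simp: aux)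
    qed (simp_all add: nonneg, simp_all add: aux)
  next
    case 3
    show ?thesis
    proof (rule immanants_nonneg_if_factorization[of t' "\<lambda>k. s k - (t' k * r' k + 1)" "\<lambda>_. 1" r' "\<lambda>_. 1"])
      show "q_nonneg (s k - (t' k * r' k + 1))" for k
        using 3 by (intro ge) (auto simp: aux mult.commute)
    qed (simp_all add: nonneg, simp_all add: aux)
  next
    case 4
    show ?thesis
    proof (rule immanants_nonneg_if_factorization[of e "\<lambda>k. s k - (e k + r k * t (Suc k))" r "\<lambda>_. 1" "\<lambda>k. t (Suc k)"])
      show "q_nonneg (s k - (e k + r k * t (Suc k)))" for k
        using 4 by (intro ge) (auto simp: aux add.commute)
    qed (simp_all add: nonneg r_nonneg, simp_all add: aux)
  next
    case 5
    show ?thesis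
      by (rule immanants_nonneg_if_factorization[of b "\<lambda>_. 0" "\<lambda>_. 1" "\<lambda>_. 1" c])
        (use 5 in simp_all)
  qed
qed

end
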